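(* For any noise level $\eta\ge1$, any positive integers $d$, $m$, $(d_u,T_u)_{u=1}^m$ and integer $B$ satisfying $d_u\le T_u$ for all $u\in[m]$, $\sum_{u=1}^m d_u\le d$, and $B\ge\sum_{u=1}^m d_u$, with $T=\sum_u T_u$, there exists an oblivious adversary such that: 1. it uses a ground truth $\theta^*\in\mathbb{R}^d$ with $\|\theta^*\|_2\le\sqrt d$ and $|\langle\theta^*,x_t\rangle|\le1$ for all $t$, and the noises $\xi_t=y_t-\langle\theta^*,x_t\rangle$ are independent zero-mean sub-Gaussian with variance proxy $\eta^2$; 2. it shows a sequence $x_1,\dots,x_T$ with $\|x_t\|_2\le1$ such that $[T]$ can be partitioned into disjoint nonempty sets $I_1,\dots,I_m$ with $|I_u|=T_u$ and $\{x_t:t\in I_u\}$ lying in a subspace of dimension $d_u$; 3. every online active learning algorithm whose expected number of label queries is at most $B$ has expected regret $\mathbb{E}[R]\ge c\,\big(\sum_{u=1}^m\sqrt{d_uT_u}\big)^2/B$, where $c>0$ is an absolute constant.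
   Context: Online active regression protocol: an oblivious adversary fixes $\theta^*\in\mathbb{R}^d$ and inputs $x_1,\dots,x_T$ in advance; labels are $y_t=\langle\theta^*,x_t\rangle+\xi_t$ with independent zero-mean noise. At each round the learner sees $x_t$, predicts $\hat y_t$ (using only previously observed information), and then decides whether to query ($q_t\in\{0,1\}$); if $q_t=1$ it observes $y_t$. Regret: $R=\sum_{t=1}^T(\hat y_t-\langle\theta^*,x_t\rangle)^2$; number of queries $Q=\sum_t q_t$.
   Formalization: The oblivious adversary draws the ground truth and inputs at random before play, independently of the learner, and expectations include this draw: for one fixed ground truth, the algorithm that always predicts its inner product with the input has zero regret with no queries. *)

theory Defs
  imports "HOL-Probability.Probability"
begin

text \<open>Vectors of R^d are represented as functions nat => real; only the
coordinates i < d are meaningful and the others are required to be 0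
wherever a vector is asserted to lie in R^d.\<close>

definition in_Rd :: "nat \<Rightarrow> (nat \<Rightarrow> real) \<Rightarrow> bool" where
  "in_Rd d x \<longleftrightarrow> (\<forall>i\<ge>d. x i = 0)"

definition inner_d :: "nat \<Rightarrow> (nat \<Rightarrow> real) \<Rightarrow> (nat \<Rightarrow> real) \<Rightarrow> real" where
  "inner_d d a b = (\<Sum>i<d. a i * b i)"

definition norm_d :: "nat \<Rightarrow> (nat \<Rightarrow> real) \<Rightarrow> real" where
  "norm_d d a = sqrt (\<Sum>i<d. (a i)\<^sup>2)"

definition in_subspace_of_dim :: "nat \<Rightarrow> nat \<Rightarrow> (nat \<Rightarrow> real) set \<Rightarrow> bool" where
  "in_subspace_of_dim d k S \<longleftrightarrow>
     (\<exists>b :: nat \<Rightarrow> nat \<Rightarrow> real.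
        (\<forall>j<k. in_Rd d (b j)) \<and>
        (\<forall>a :: nat \<Rightarrow> real. (\<forall>i. (\<Sum>j<k. a j * b j i) = 0) \<longrightarrow> (\<forall>j<k. a j = 0)) \<and>
        (\<forall>x\<in>S. \<exists>a :: nat \<Rightarrow> real. \<forall>i. x i = (\<Sum>j<k. a j * b j i)))"

definition subgaussian :: "real measure \<Rightarrow> real \<Rightarrow> bool" where
  "subgaussian N \<sigma> \<longleftrightarrow> prob_space N \<and> sets N = sets borel \<and>
     integrable N (\<lambda>x. x) \<and> (\<integral>x. x \<partial>N) = 0 \<and>
     (\<forall>l::real. integrable N (\<lambda>x. exp (l * x)) \<and>
        (\<integral>x. exp (l * x) \<partial>N) \<le> exp (l\<^sup>2 * \<sigma>\<^sup>2 / 2))"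

text \<open>Learner's observation history: past inputs together with the label if it
was queried.\<close>
type_synonym history = "((nat \<Rightarrow> real) \<times> real option) list"

text \<open>A (randomized) learner is given by a random seed r :: real and two maps:
  pred r t h x  -- the prediction at round t (rounds 0..T-1), from the history h
                   of previous rounds and the current input x;
  qry r t h x   -- whether to query the label at round t.
hist_of computes the history before round t, given inputs X and labels Y.\<close>
fun hist_of :: "(real \<Rightarrow> nat \<Rightarrow> history \<Rightarrow> (nat \<Rightarrow> real) \<Rightarrow> bool) \<Rightarrow> real \<Rightarrow>
    (nat \<Rightarrow> nat \<Rightarrow> real) \<Rightarrow> (nat \<Rightarrow> real) \<Rightarrow> nat \<Rightarrow> history" where
  "hist_of qry r X Y 0 = []"
| "hist_of qry r X Y (Suc t) = hist_of qry r X Y t @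
     [(X t, if qry r t (hist_of qry r X Y t) (X t) then Some (Y t) else None)]"

definition regret :: "nat \<Rightarrow> nat \<Rightarrow> (real \<Rightarrow> nat \<Rightarrow> history \<Rightarrow> (nat \<Rightarrow> real) \<Rightarrow> real) \<Rightarrow>
    (real \<Rightarrow> nat \<Rightarrow> history \<Rightarrow> (nat \<Rightarrow> real) \<Rightarrow> bool) \<Rightarrow> real \<Rightarrow>
    (nat \<Rightarrow> real) \<Rightarrow> (nat \<Rightarrow> nat \<Rightarrow> real) \<Rightarrow> (nat \<Rightarrow> real) \<Rightarrow> real" where
  "regret d T pred qry r \<theta> X Y =
     (\<Sum>t<T. (pred r t (hist_of qry r X Y t) (X t) - inner_d d \<theta> (X t))\<^sup>2)"

definition nqueries :: "nat \<Rightarrow> (real \<Rightarrow> nat \<Rightarrow> history \<Rightarrow> (nat \<Rightarrow> real) \<Rightarrow> bool) \<Rightarrow> real \<Rightarrow>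
    (nat \<Rightarrow> nat \<Rightarrow> real) \<Rightarrow> (nat \<Rightarrow> real) \<Rightarrow> nat" where
  "nqueries T qry r X Y = card {t. t < T \<and> qry r t (hist_of qry r X Y t) (X t)}"

definition labels :: "nat \<Rightarrow> (nat \<Rightarrow> real) \<Rightarrow> (nat \<Rightarrow> nat \<Rightarrow> real) \<Rightarrow> (nat \<Rightarrow> real) \<Rightarrow> nat \<Rightarrow> real" where
  "labels d \<theta> X \<xi> t = inner_d d \<theta> (X t) + \<xi> t"

text \<open>Joint probability space: oblivious adversary randomness A over (theta*, X),
independent noises N t for t < T, independent learner seed R.\<close>
definition joint :: "((nat \<Rightarrow> real) \<times> (nat \<Rightarrow> nat \<Rightarrow> real)) measure \<Rightarrow> nat \<Rightarrow>
    (nat \<Rightarrow> real measure) \<Rightarrow> real measure \<Rightarrow>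
    (((nat \<Rightarrow> real) \<times> (nat \<Rightarrow> nat \<Rightarrow> real)) \<times> (nat \<Rightarrow> real) \<times> real) measure" where
  "joint A T N R = A \<Otimes>\<^sub>M (PiM {..<T} N \<Otimes>\<^sub>M R)"

definition exp_regret where
  "exp_regret d T A N R pred qry =
     (\<integral>\<^sup>+ z. ennreal (case z of ((\<theta>, X), (\<xi>, r)) \<Rightarrow> regret d T pred qry r \<theta> X (labels d \<theta> X \<xi>))
        \<partial>joint A T N R)"

definition exp_queries where
  "exp_queries d T A N R qry =
     (\<integral>\<^sup>+ z. ennreal (case z of ((\<theta>, X), (\<xi>, r)) \<Rightarrow> real (nqueries T qry r X (labels d \<theta> X \<xi>)))
        \<partial>joint A T N R)"

text \<open>Measurability of the interaction (needed for the expectations to be meaningful).\<close>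
definition measurable_learner where
  "measurable_learner d T A N R pred qry \<longleftrightarrow>
     (\<lambda>z. case z of ((\<theta>, X), (\<xi>, r)) \<Rightarrow> regret d T pred qry r \<theta> X (labels d \<theta> X \<xi>))
        \<in> borel_measurable (joint A T N R) \<and>
     (\<lambda>z. case z of ((\<theta>, X), (\<xi>, r)) \<Rightarrow> real (nqueries T qry r X (labels d \<theta> X \<xi>)))
        \<in> borel_measurable (joint A T N R)"

end

theory Submission
  imports Defs
begin

text \<open>
  The inputs are standard basis vectors of \<open>D = \<Sum>u<m. dU u\<close> coordinates, each coordinate of block \<open>u\<close>
  being shown \<open>n i \<ge> TU u / (2 * dU u)\<close> times. The ground truth has independent uniform signs,
  \<open>\<theta> i = \<plusminus> 1 / sqrt (K i)\<close>, and the noise is a centred binomial law on the matching lattice, for which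
  the Hellinger affinity between the two label laws of coordinate \<open>i\<close> is at least \<open>1 - 1 / K i\<close>.

  Fix the learner's seed. Averaging over a sign and over the queried labels, the affinity of the two
  laws of the history drops by at most \<open>1 / K i\<close> per expected query of coordinate \<open>i\<close>, so the Bayes risk
  of that coordinate is at least \<open>n i / K i * (1 - 2 * q i / K i)\<close>, with \<open>q i\<close> the expected number of
  its queries. Choosing \<open>K i\<close> proportional to \<open>B * sqrt (n i) / (\<Sum>j<D. sqrt (n j))\<close> makes \<open>n i / (K i)\<^sup>2\<close>
  bounded by a constant \<open>lam\<close>. Regret plus \<open>2 * lam\<close> times the number of queries is therefore bounded
  below for every seed; being linear, this bound survives integration over the seed.
\<close>

section \<open>Histories and likelihoods\<close>

text \<open>Only queried labels contribute: at a fixed seed the query decisions are determined by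
  the history, so they carry no factor. The position in the list is the round.\<close>

definition lik :: "(nat \<Rightarrow> real \<Rightarrow> real) \<Rightarrow> history \<Rightarrow> real" where
  "lik p h = (\<Prod>s<length h. case snd (h ! s) of None \<Rightarrow> 1 | Some y \<Rightarrow> p s y)"

text \<open>With weight 1 this counts queries, with the indicator of a coordinate it counts the
  queries of that coordinate, and with the affinity loss of each round it measures the information
  bought.\<close>

definition query_weight :: "(nat \<Rightarrow> real) \<Rightarrow> history \<Rightarrow> real" where
  "query_weight \<delta> h = (\<Sum>s<length h. if snd (h ! s) = None then 0 else \<delta> s)"

lemma lik_Nil [simp]: "lik p [] = 1"
  by (simp add: lik_def)

lemma lik_snoc: "lik p (h @ [z]) = lik p h * (case snd z of None \<Rightarrow> 1 | Some y \<Rightarrow> p (length h) y)"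
  by (auto simp: lik_def nth_append intro!: prod.cong)

lemma query_weight_Nil [simp]: "query_weight \<delta> [] = 0"
  by (simp add: query_weight_def)

lemma query_weight_snoc:
  "query_weight \<delta> (h @ [z]) = query_weight \<delta> h + (if snd z = None then 0 else \<delta> (length h))"
  by (auto simp: query_weight_def nth_append intro!: sum.cong)

lemma lik_nonneg:
  assumes "\<And>s y. 0 \<le> p s y"
  shows "0 \<le> lik p h"
  unfolding lik_def by (intro prod_nonneg ballI) (auto split: option.splits intro: assms)

text \<open>The Hellinger affinity thereby sums a likelihood too, that of the unnormalised geometric
  mean of the two laws, so the recursion for \<open>lik\<close> applies to it.\<close>

lemma lik_sqrt: "lik (\<lambda>s y. sqrt (p s y * p' s y)) h = sqrt (lik p h * lik p' h)"
proof (induction h rule: rev_induct)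
  case (snoc z h)
  then show ?case by (auto simp: lik_snoc real_sqrt_mult split: option.splits)
qed simp

lemma query_weight_sum:
  "query_weight (\<lambda>s. \<Sum>i\<in>A. \<delta> i s) h = (\<Sum>i\<in>A. query_weight (\<delta> i) h)"
  unfolding query_weight_def by (subst sum.swap) (auto intro!: sum.cong)

lemma query_weight_cmult: "query_weight (\<lambda>s. a * \<delta> s) h = a * query_weight \<delta> h"
  unfolding query_weight_def by (auto simp: sum_distrib_left intro!: sum.cong)

lemma query_weight_cong:
  "(\<And>s. s < length h \<Longrightarrow> \<delta> s = \<delta>' s) \<Longrightarrow> query_weight \<delta> h = query_weight \<delta>' h"
  unfolding query_weight_def by (auto intro!: sum.cong)

lemma length_hist_of [simp]: "length (hist_of qry r X Y t) = t"
  by (induction t) auto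

lemma take_hist_of: "t \<le> T \<Longrightarrow> take t (hist_of qry r X Y T) = hist_of qry r X Y t"
  by (induction T) (auto simp: le_Suc_eq)

lemma hist_of_cong: "(\<And>s. s < t \<Longrightarrow> Y s = Y' s) \<Longrightarrow> hist_of qry r X Y t = hist_of qry r X Y' t"
  by (induction t) auto

lemma nqueries_eq_query_weight:
  "real (nqueries T qry r X Y) = query_weight (\<lambda>_. 1) (hist_of qry r X Y T)"
proof (induction T)
  case (Suc T)
  have "{t. t < Suc T \<and> qry r t (hist_of qry r X Y t) (X t)} =
      (if qry r T (hist_of qry r X Y T) (X T) then insert T else id)
      {t. t < T \<and> qry r t (hist_of qry r X Y t) (X t)}"
    by (auto simp: less_Suc_eq)
  then show ?case using Suc by (auto simp: nqueries_def query_weight_snoc)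
qed (simp add: nqueries_def)

text \<open>Every earlier history is a prefix of the last one. For fixed truth and inputs the regret
  is thus a function of the final history, which can be averaged over the tree.\<close>

lemma regret_eq_hist:
  "regret d T pred qry r \<theta> X Y =
    (\<Sum>t<T. (pred r t (take t (hist_of qry r X Y T)) (X t) - inner_d d \<theta> (X t))\<^sup>2)"
  unfolding regret_def by (intro sum.cong) (simp_all add: take_hist_of)

text \<open>Here \<open>g\<close> is one prediction for the two truths \<open>e\<close> and
  \<open>-e\<close>. For \<open>a + b > 0\<close> the exact minimum over \<open>g\<close> is
  \<open>4 * a * b * e^2 / (a + b)\<close>; the weaker bound is linear in
  \<open>sqrt (a * b)\<close>, \<open>a\<close> and \<open>b\<close>, so it can be summed over
  histories.\<close>

lemma bayes_two_point:
  fixes a b g e :: real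
  assumes "0 \<le> a" "0 \<le> b"
  shows "e\<^sup>2 * (4 * sqrt (a * b) - a - b) \<le> a * (g - e)\<^sup>2 + b * (g + e)\<^sup>2"
proof -
  obtain \<alpha> \<beta> where ab: "a = \<alpha>\<^sup>2" "b = \<beta>\<^sup>2" "0 \<le> \<alpha>" "0 \<le> \<beta>"
    using assms by (metis real_sqrt_ge_zero real_sqrt_pow2)
  \<comment> \<open>Completing the square in \<open>\<alpha> - \<beta>\<close> and \<open>\<alpha> + \<beta>\<close>.\<close>
  have "a * (g - e)\<^sup>2 + b * (g + e)\<^sup>2 - e\<^sup>2 * (4 * (\<alpha> * \<beta>) - a - b) =
      ((\<alpha> - \<beta>) * g)\<^sup>2 / 2 + ((\<alpha> + \<beta>) * g - 2 * e * (\<alpha> - \<beta>))\<^sup>2 / 2"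
    unfolding ab by (simp add: power2_eq_square field_simps)
  moreover have "sqrt (a * b) = \<alpha> * \<beta>"
    using ab by (simp add: real_sqrt_mult)
  ultimately show ?thesis
    by (smt (verit) zero_le_power2 divide_nonneg_nonneg)
qed

section \<open>Sums over the query tree and the affinity of two laws of the history\<close>

locale label_tree =
  fixes qry :: "real \<Rightarrow> nat \<Rightarrow> history \<Rightarrow> (nat \<Rightarrow> real) \<Rightarrow> bool" and r :: real
    and X :: "nat \<Rightarrow> nat \<Rightarrow> real" and V :: "nat \<Rightarrow> real set"
  assumes finite_V: "\<And>t. finite (V t)"
begin

text \<open>The sum of \<open>f\<close> over all histories of length \<open>t\<close> that the query rule can produce when
  labels at round \<open>s\<close> range over \<open>V s\<close>; a label that is not queried is not branched on. Weighting by
  \<open>lik p\<close> gives the expectation under label laws \<open>p\<close>, and all label laws share the same tree.\<close>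

primrec tree_sum :: "nat \<Rightarrow> (history \<Rightarrow> real) \<Rightarrow> real" where
  "tree_sum 0 f = f []"
| "tree_sum (Suc t) f = tree_sum t (\<lambda>h.
     if qry r t h (X t) then \<Sum>y\<in>V t. f (h @ [(X t, Some y)]) else f (h @ [(X t, None)]))"

lemma tree_sum_mono:
  "(\<And>h. length h = t \<Longrightarrow> f h \<le> g h) \<Longrightarrow> tree_sum t f \<le> tree_sum t g"
proof (induction t arbitrary: f g)
  case (Suc t)
  show ?case unfolding tree_sum.simps
    by (rule Suc.IH) (auto intro!: sum_mono Suc.prems)
qed auto

lemma tree_sum_cong:
  "(\<And>h. length h = t \<Longrightarrow> f h = g h) \<Longrightarrow> tree_sum t f = tree_sum t g"
  by (intro antisym tree_sum_mono) auto

lemma tree_sum_add: "tree_sum t (\<lambda>h. f h + g h) = tree_sum t f + tree_sum t g"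
proof (induction t arbitrary: f g)
  case (Suc t)
  show ?case unfolding tree_sum.simps Suc.IH[symmetric]
    by (rule tree_sum_cong) (auto simp: sum.distrib)
qed auto

lemma tree_sum_cmult: "tree_sum t (\<lambda>h. a * f h) = a * tree_sum t f"
proof (induction t arbitrary: f)
  case (Suc t)
  show ?case unfolding tree_sum.simps Suc.IH[symmetric]
    by (rule tree_sum_cong) (auto simp: sum_distrib_left)
qed auto

lemma tree_sum_diff: "tree_sum t (\<lambda>h. f h - g h) = tree_sum t f - tree_sum t g"
  using tree_sum_add[of t f "\<lambda>h. (-1) * g h"] tree_sum_cmult[of t "-1" g] by simp

lemma tree_sum_sum: "tree_sum t (\<lambda>h. \<Sum>i\<in>A. f i h) = (\<Sum>i\<in>A. tree_sum t (f i))"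
proof (induction A rule: infinite_finite_induct)
  case (insert x F)
  then show ?case by (simp add: tree_sum_add)
qed (use tree_sum_cmult[of t 0 "\<lambda>_. 0"] in simp_all)

text \<open>Tower property: the last round is averaged first, given the history before it. The
  weights \<open>p\<close> are arbitrary so that geometric means of two laws are covered.\<close>

lemma tree_sum_lik_Suc:
  "tree_sum (Suc t) (\<lambda>h. lik p h * f h) = tree_sum t (\<lambda>h. lik p h *
     (if qry r t h (X t) then \<Sum>y\<in>V t. p t y * f (h @ [(X t, Some y)]) else f (h @ [(X t, None)])))"
  unfolding tree_sum.simps
  by (rule tree_sum_cong) (auto simp: lik_snoc sum_distrib_left mult_ac)

lemma tree_sum_lik:
  assumes "\<And>s. s < t \<Longrightarrow> (\<Sum>y\<in>V s. p s y) = 1"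
  shows "tree_sum t (lik p) = 1"
  using assms
proof (induction t)
  case (Suc t)
  have "tree_sum (Suc t) (lik p) = tree_sum t (\<lambda>h. lik p h *
      (if qry r t h (X t) then \<Sum>y\<in>V t. p t y * 1 else 1))"
    using tree_sum_lik_Suc[of t p "\<lambda>_. 1"] by simp
  also have "\<dots> = tree_sum t (lik p)"
    using Suc.prems by (intro tree_sum_cong) auto
  finally show ?case using Suc by simp
qed simp

lemma tree_sum_query_weight_Suc:
  assumes "(\<Sum>y\<in>V t. p t y) = 1"
  shows "tree_sum (Suc t) (\<lambda>h. lik p h * query_weight \<delta> h) =
    tree_sum t (\<lambda>h. lik p h * query_weight \<delta> h) +
    \<delta> t * tree_sum t (\<lambda>h. lik p h * (if qry r t h (X t) then 1 else 0))"
proof -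
  have "tree_sum (Suc t) (\<lambda>h. lik p h * query_weight \<delta> h) =
      tree_sum t (\<lambda>h. lik p h * query_weight \<delta> h +
        \<delta> t * (lik p h * (if qry r t h (X t) then 1 else 0)))"
    unfolding tree_sum_lik_Suc
    using assms by (intro tree_sum_cong)
      (auto simp: query_weight_snoc algebra_simps sum.distrib sum_distrib_left[symmetric])
  then show ?thesis by (simp add: tree_sum_add tree_sum_cmult)
qed

text \<open>Induction over the rounds. An unqueried round keeps the affinity; a queried one
  multiplies the contribution of a history by at least \<open>1 - \<delta> t\<close>. By AM-GM that
  loss is at most \<open>\<delta> t\<close> times the mean of the two likelihoods, so the losses add
  up to an expected query weight even for adaptive queries.\<close>

lemma tree_affinity_ge:
  assumes p0: "\<And>s y. 0 \<le> p s y" and p'0: "\<And>s y. 0 \<le> p' s y"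
    and p1: "\<And>s. s < t \<Longrightarrow> (\<Sum>y\<in>V s. p s y) = 1"
    and p'1: "\<And>s. s < t \<Longrightarrow> (\<Sum>y\<in>V s. p' s y) = 1"
    and \<delta>0: "\<And>s. s < t \<Longrightarrow> 0 \<le> \<delta> s"
    and aff: "\<And>s. s < t \<Longrightarrow> 1 - \<delta> s \<le> (\<Sum>y\<in>V s. sqrt (p s y * p' s y))"
  shows "1 - (tree_sum t (\<lambda>h. lik p h * query_weight \<delta> h) +
              tree_sum t (\<lambda>h. lik p' h * query_weight \<delta> h)) / 2
         \<le> tree_sum t (\<lambda>h. sqrt (lik p h * lik p' h))"
  using p1 p'1 \<delta>0 aff
proof (induction t)
  case 0
  then show ?case by simp
next
  case (Suc t)
  let ?Q = "\<lambda>h. if qry r t h (X t) then 1 else (0::real)"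
  define w where "w = (\<lambda>h. sqrt (lik p h * lik p' h))"
  have w0: "0 \<le> w h" for h
    by (simp add: w_def lik_nonneg p0 p'0)
  have amgm: "w h \<le> (lik p h + lik p' h) / 2" for h
    unfolding w_def by (intro arith_geo_mean_sqrt lik_nonneg p0 p'0)
  have IH: "1 - (tree_sum t (\<lambda>h. lik p h * query_weight \<delta> h) +
       tree_sum t (\<lambda>h. lik p' h * query_weight \<delta> h)) / 2 \<le> tree_sum t w"
    unfolding w_def by (rule Suc.IH) (use Suc.prems in auto)
  have "tree_sum t w - \<delta> t * ((tree_sum t (\<lambda>h. lik p h * ?Q h) +
         tree_sum t (\<lambda>h. lik p' h * ?Q h)) / 2)
      = tree_sum t (\<lambda>h. w h - \<delta> t * ((1/2) * (lik p h * ?Q h + lik p' h * ?Q h)))"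
    unfolding tree_sum_diff tree_sum_cmult tree_sum_add by (simp add: field_simps)
  also have "\<dots> \<le> tree_sum t (\<lambda>h. w h *
      (if qry r t h (X t) then \<Sum>y\<in>V t. sqrt (p t y * p' t y) * 1 else 1))"
  proof (rule tree_sum_mono)
    fix h :: history
    \<comment> \<open>This chain serves the queried case; without a query both sides of the goal are
      \<open>w h\<close>.\<close>
    have "w h - \<delta> t * ((lik p h + lik p' h) / 2) \<le> w h - \<delta> t * w h"
      using mult_left_mono[OF amgm[of h], of "\<delta> t"] Suc.prems(3)[of t] by simp
    also have "\<dots> = w h * (1 - \<delta> t)"
      by (simp add: algebra_simps)
    also have "\<dots> \<le> w h * (\<Sum>y\<in>V t. sqrt (p t y * p' t y))"
      using Suc.prems(4)[of t] w0 by (intro mult_left_mono) auto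
    finally show "w h - \<delta> t * ((1/2) * (lik p h * ?Q h + lik p' h * ?Q h))
        \<le> w h * (if qry r t h (X t) then \<Sum>y\<in>V t. sqrt (p t y * p' t y) * 1 else 1)"
      by simp
  qed
  also have "\<dots> = tree_sum (Suc t) w"
    using tree_sum_lik_Suc[of t "\<lambda>s y. sqrt (p s y * p' s y)" "\<lambda>_. 1"]
    by (simp add: lik_sqrt w_def)
  finally show ?case
    using IH Suc.prems(1,2)
    unfolding w_def[symmetric] by (simp add: tree_sum_query_weight_Suc field_simps del: tree_sum.simps)
qed

text \<open>Sum \<open>bayes_two_point\<close> over histories and over the rounds in
  \<open>C\<close>. Each likelihood has total mass 1, so the bound is four affinities minus 2, and
  an affinity of at least \<open>1 - E / 2\<close> leaves \<open>2 - 2 * E\<close>.\<close>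

lemma two_point_regret_ge:
  assumes p0: "\<And>s y. 0 \<le> p s y" and p'0: "\<And>s y. 0 \<le> p' s y"
    and p1: "\<And>s. s < T \<Longrightarrow> (\<Sum>y\<in>V s. p s y) = 1"
    and p'1: "\<And>s. s < T \<Longrightarrow> (\<Sum>y\<in>V s. p' s y) = 1"
    and \<delta>0: "\<And>s. s < T \<Longrightarrow> 0 \<le> \<delta> s"
    and aff: "\<And>s. s < T \<Longrightarrow> 1 - \<delta> s \<le> (\<Sum>y\<in>V s. sqrt (p s y * p' s y))"
  shows "real (card C) * e\<^sup>2 * (2 - 2 * (tree_sum T (\<lambda>h. lik p h * query_weight \<delta> h) +
              tree_sum T (\<lambda>h. lik p' h * query_weight \<delta> h)))
     \<le> tree_sum T (\<lambda>h. lik p h * (\<Sum>t\<in>C. (g t h - e)\<^sup>2)) +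
       tree_sum T (\<lambda>h. lik p' h * (\<Sum>t\<in>C. (g t h + e)\<^sup>2))"
proof -
  let ?E = "tree_sum T (\<lambda>h. lik p h * query_weight \<delta> h) +
              tree_sum T (\<lambda>h. lik p' h * query_weight \<delta> h)"
  have "1 - ?E / 2 \<le> tree_sum T (\<lambda>h. sqrt (lik p h * lik p' h))"
    by (rule tree_affinity_ge) (use assms in auto)
  then have "real (card C) * e\<^sup>2 * (2 - 2 * ?E) \<le>
      real (card C) * e\<^sup>2 * (4 * tree_sum T (\<lambda>h. sqrt (lik p h * lik p' h)) - 1 - 1)"
    by (intro mult_left_mono) (simp_all add: field_simps)
  also have "\<dots> = (\<Sum>t\<in>C. e\<^sup>2 * (4 * tree_sum T (\<lambda>h. sqrt (lik p h * lik p' h)) -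
      tree_sum T (lik p) - tree_sum T (lik p')))"
    using tree_sum_lik[of T p, OF p1] tree_sum_lik[of T p', OF p'1] by simp
  also have "\<dots> = tree_sum T (\<lambda>h. \<Sum>t\<in>C. e\<^sup>2 * (4 * sqrt (lik p h * lik p' h) - lik p h - lik p' h))"
    by (simp only: tree_sum_sum tree_sum_diff tree_sum_cmult)
  also have "\<dots> \<le> tree_sum T (\<lambda>h. \<Sum>t\<in>C. lik p h * (g t h - e)\<^sup>2 + lik p' h * (g t h + e)\<^sup>2)"
    by (intro tree_sum_mono sum_mono bayes_two_point lik_nonneg p0 p'0)
  also have "\<dots> = tree_sum T (\<lambda>h. lik p h * (\<Sum>t\<in>C. (g t h - e)\<^sup>2)) +
       tree_sum T (\<lambda>h. lik p' h * (\<Sum>t\<in>C. (g t h + e)\<^sup>2))"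
    by (simp add: sum.distrib sum_distrib_left tree_sum_add)
  finally show ?thesis .
qed

text \<open>Passes from noise vectors to histories. A queried noise value is shifted to the label it
  produces, where points of \<open>V\<close> outside the shifted support have weight 0; an unqueried
  one sums out to 1.\<close>

lemma sum_noise_eq_tree_sum:
  assumes sub: "\<And>t x. t < T \<Longrightarrow> x \<in> S t \<Longrightarrow> \<mu> t + x \<in> V t"
    and zero: "\<And>t x. t < T \<Longrightarrow> x \<notin> S t \<Longrightarrow> p t x = 0"
    and fin: "\<And>t. t < T \<Longrightarrow> finite (S t)"
    and one: "\<And>t. t < T \<Longrightarrow> (\<Sum>x\<in>S t. p t x) = 1"
  shows "(\<Sum>\<xi>\<in>PiE {..<T} S. (\<Prod>t<T. p t (\<xi> t)) * f (hist_of qry r X (\<lambda>t. \<mu> t + \<xi> t) T)) =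
    tree_sum T (\<lambda>h. lik (\<lambda>t y. p t (y - \<mu> t)) h * f h)"
  using assms
proof (induction T arbitrary: f)
  case (Suc T)
  \<comment> \<open>\<open>F\<close> averages \<open>f\<close> over the last round given the
    history; the induction hypothesis is applied to it.\<close>
  define F where "F = (\<lambda>h. if qry r T h (X T)
       then \<Sum>y\<in>V T. p T (y - \<mu> T) * f (h @ [(X T, Some y)]) else f (h @ [(X T, None)]))"
  have sumV: "(\<Sum>x\<in>S T. p T x * G (\<mu> T + x)) = (\<Sum>y\<in>V T. p T (y - \<mu> T) * G y)" for G
  proof -
    have "(\<Sum>x\<in>S T. p T x * G (\<mu> T + x)) = (\<Sum>y\<in>(\<lambda>x. \<mu> T + x) ` S T. p T (y - \<mu> T) * G y)"
      by (subst sum.reindex) (auto simp: inj_on_def)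
    also have "\<dots> = (\<Sum>y\<in>V T. p T (y - \<mu> T) * G y)"
    proof (rule sum.mono_neutral_left)
      show "\<forall>y\<in>V T - (\<lambda>x. \<mu> T + x) ` S T. p T (y - \<mu> T) * G y = 0"
      proof
        fix y assume "y \<in> V T - (\<lambda>x. \<mu> T + x) ` S T"
        then have "y - \<mu> T \<notin> S T"
          by (metis DiffD2 add.commute diff_add_cancel image_eqI)
        then show "p T (y - \<mu> T) * G y = 0"
          using Suc.prems(2)[of T] by simp
      qed
    qed (use finite_V Suc.prems in auto)
    finally show ?thesis .
  qed
  let ?w = "\<lambda>\<xi>. \<Prod>t<T. p t (\<xi> t)"
  let ?H = "\<lambda>\<xi>. hist_of qry r X (\<lambda>t. \<mu> t + \<xi> t) T"
  have step: "(\<Sum>x\<in>S T. ?w \<xi> * p T x * f (hist_of qry r X (\<lambda>t. \<mu> t + (\<xi>(T := x)) t) (Suc T)))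
      = ?w \<xi> * F (?H \<xi>)" for \<xi>
  proof -
    have pre: "hist_of qry r X (\<lambda>t. \<mu> t + (\<xi>(T := x)) t) T = ?H \<xi>" for x
      by (rule hist_of_cong) auto
    show ?thesis
    proof (cases "qry r T (?H \<xi>) (X T)")
      case True
      have "(\<Sum>x\<in>S T. ?w \<xi> * p T x * f (hist_of qry r X (\<lambda>t. \<mu> t + (\<xi>(T := x)) t) (Suc T)))
          = ?w \<xi> * (\<Sum>x\<in>S T. p T x * f (?H \<xi> @ [(X T, Some (\<mu> T + x))]))"
        unfolding hist_of.simps pre using True by (simp add: sum_distrib_left mult.assoc)
      also have "\<dots> = ?w \<xi> * F (?H \<xi>)"
        using True sumV[of "\<lambda>y. f (?H \<xi> @ [(X T, Some y)])"] by (simp add: F_def)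
      finally show ?thesis .
    next
      case False
      \<comment> \<open>An unqueried label does not enter the history, so its noise sums
        out.\<close>
      have "(\<Sum>x\<in>S T. p T x) = 1"
        using Suc.prems(4)[of T] by simp
      with False show ?thesis
        unfolding hist_of.simps pre
        by (simp add: F_def sum_distrib_left[symmetric] sum_distrib_right[symmetric])
    qed
  qed
  have "(\<Sum>\<xi>\<in>PiE {..<Suc T} S. (\<Prod>t<Suc T. p t (\<xi> t)) *
        f (hist_of qry r X (\<lambda>t. \<mu> t + \<xi> t) (Suc T)))
      = (\<Sum>(x, \<xi>)\<in>S T \<times> PiE {..<T} S. (\<Prod>t<Suc T. p t ((\<xi>(T := x)) t)) *
        f (hist_of qry r X (\<lambda>t. \<mu> t + (\<xi>(T := x)) t) (Suc T)))"
    unfolding lessThan_Suc PiE_insert_eq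
    by (subst sum.reindex[OF inj_combinator]) (simp_all add: case_prod_unfold o_def del: hist_of.simps fun_upd_apply)
  also have "\<dots> = (\<Sum>\<xi>\<in>PiE {..<T} S. \<Sum>x\<in>S T. (\<Prod>t<Suc T. p t ((\<xi>(T := x)) t)) *
        f (hist_of qry r X (\<lambda>t. \<mu> t + (\<xi>(T := x)) t) (Suc T)))"
    by (subst sum.swap) (simp add: sum.cartesian_product)
  also have "\<dots> = (\<Sum>\<xi>\<in>PiE {..<T} S. \<Sum>x\<in>S T. ?w \<xi> * p T x *
        f (hist_of qry r X (\<lambda>t. \<mu> t + (\<xi>(T := x)) t) (Suc T)))"
    by (intro sum.cong refl) (auto simp del: hist_of.simps intro!: prod.cong)
  also have "\<dots> = (\<Sum>\<xi>\<in>PiE {..<T} S. ?w \<xi> * F (?H \<xi>))"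
    by (simp only: step)
  also have "\<dots> = tree_sum T (\<lambda>h. lik (\<lambda>t y. p t (y - \<mu> t)) h * F h)"
    by (rule Suc.IH) (use Suc.prems in auto)
  also have "\<dots> = tree_sum (Suc T) (\<lambda>h. lik (\<lambda>t y. p t (y - \<mu> t)) h * f h)"
    unfolding tree_sum_lik_Suc F_def ..
  finally show ?case .
qed simp

end

section \<open>Lattice noise\<close>

text \<open>The noise lives on a lattice of step \<open>2 / sqrt K\<close>, so that shifting it by \<open>\<plusminus> 1 / sqrt K\<close> gives two
  laws on one and the same lattice. It is a rescaled sum of \<open>K - 1\<close> random signs, hence sub-Gaussian with
  proxy at most 1. Its support being finite, only the learner's seed needs measure theory.\<close>

definition lattice_noise :: "nat \<Rightarrow> real pmf" where
  "lattice_noise K = map_pmf (\<lambda>k. (2 * real k - real (K - 1)) / sqrt (real K)) (binomial_pmf (K - 1) (1/2))"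

text \<open>For \<open>K > 0\<close> this is the union of the supports of the noise shifted by
  \<open>1 / sqrt K\<close> up and down; it has one point more than the noise.\<close>

definition label_lattice :: "nat \<Rightarrow> real set" where
  "label_lattice K = (\<lambda>j. (2 * real j - real K) / sqrt (real K)) ` {..K}"

lemma inj_lattice: "K > 0 \<Longrightarrow> inj (\<lambda>k::nat. (2 * real k - a) / sqrt (real K))"
  by (auto simp: inj_def)

lemma set_lattice_noise:
  "set_pmf (lattice_noise K) = (\<lambda>k. (2 * real k - real (K - 1)) / sqrt (real K)) ` {..K - 1}"
  by (simp add: lattice_noise_def)

lemma finite_set_lattice_noise [simp]: "finite (set_pmf (lattice_noise K))"
  by (simp add: set_lattice_noise)

lemma pmf_lattice_noise:
  assumes "K > 0"
  shows "pmf (lattice_noise K) ((2 * real k - real (K - 1)) / sqrt (real K)) = real ((K - 1) choose k) / 2 ^ (K - 1)"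
proof -
  have "pmf (lattice_noise K) ((2 * real k - real (K - 1)) / sqrt (real K)) = pmf (binomial_pmf (K - 1) (1/2)) k"
    unfolding lattice_noise_def using pmf_map_inj'[OF inj_lattice[OF assms]] .
  also have "\<dots> = real ((K - 1) choose k) / 2 ^ (K - 1)"
  proof (cases "k \<le> K - 1")
    case True
    then have "(1/2::real) ^ k * (1/2) ^ (K - 1 - k) = (1/2) ^ (K - 1)"
      by (metis le_add_diff_inverse power_add)
    then show ?thesis by (simp add: power_one_over field_simps)
  qed (simp add: binomial_eq_0)
  finally show ?thesis .
qed

lemma lattice_noise_shift_up:
  assumes "x \<in> set_pmf (lattice_noise K)" "K > 0"
  shows "1 / sqrt (real K) + x \<in> label_lattice K"
proof -
  obtain k where k: "k \<le> K - 1" "x = (2 * real k - real (K - 1)) / sqrt (real K)"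
    using assms by (auto simp: set_lattice_noise)
  then have "1 / sqrt (real K) + x = (2 * real (Suc k) - real K) / sqrt (real K)"
    using assms(2) by (simp add: add_divide_distrib[symmetric] of_nat_diff)
  moreover have "Suc k \<in> {..K}"
    using k assms(2) by simp
  ultimately show ?thesis
    unfolding label_lattice_def by (rule image_eqI)
qed

lemma lattice_noise_shift_down:
  assumes "x \<in> set_pmf (lattice_noise K)" "K > 0"
  shows "- (1 / sqrt (real K)) + x \<in> label_lattice K"
proof -
  obtain k where k: "k \<le> K - 1" "x = (2 * real k - real (K - 1)) / sqrt (real K)"
    using assms by (auto simp: set_lattice_noise)
  then have "- (1 / sqrt (real K)) + x = (2 * real k - real K) / sqrt (real K)"
    using assms(2) by (simp add: diff_divide_distrib[symmetric] of_nat_diff)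
  moreover have "k \<in> {..K}"
    using k assms(2) by simp
  ultimately show ?thesis
    unfolding label_lattice_def by (rule image_eqI)
qed

text \<open>By absorption the two neighbouring coefficients are \<open>c / (Suc M - i)\<close> and
  \<open>c / Suc i\<close> with the same \<open>c = Suc M * (M choose i)\<close>. The denominators
  add up to \<open>M + 2\<close>, so the left side is the harmonic mean of the coefficients.\<close>

lemma choose_consecutive_ge:
  assumes "i \<le> M"
  shows "2 * real (Suc M) / real (M + 2) * real (M choose i) \<le>
    sqrt (real (Suc M choose i) * real (Suc M choose Suc i))"
proof -
  have e1: "real (Suc M choose i) * real (Suc M - i) = real (Suc M) * real (M choose i)"
    using binomial_absorb_comp[of "Suc M" i]  by (metis diff_Suc_1 mult.commute of_nat_mult)
  have e2: "real (Suc M choose Suc i) * real (Suc i) = real (Suc M) * real (M choose i)"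
    using Suc_times_binomial_eq[of M i] by (metis of_nat_mult)
  define u v c where "u = real (Suc M - i)" "v = real (Suc i)" "c = real (Suc M) * real (M choose i)"
  have uv: "u > 0" "v > 0" "u + v = real (M + 2)" "c \<ge> 0"
    using assms by (auto simp: u_v_c_def of_nat_diff)
  have "real (Suc M choose i) = c / u" "real (Suc M choose Suc i) = c / v"
    using e1 e2 uv by (simp_all add: u_v_c_def field_simps)
  \<comment> \<open>The harmonic mean is at most the geometric mean.\<close>
  moreover have "2 * c / (u + v) \<le> sqrt (c / u * (c / v))"
  proof (rule real_le_rsqrt)
    have "4 * (u * v) \<le> (u + v)\<^sup>2"
      using zero_le_power2[of "u - v"] by (simp add: power2_eq_square algebra_simps)
    then have "4 / (u + v)\<^sup>2 \<le> 1 / (u * v)"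
      using uv by (simp add: field_simps)
    then have "4 / (u + v)\<^sup>2 * c\<^sup>2 \<le> 1 / (u * v) * c\<^sup>2"
      by (rule mult_right_mono) simp
    then show "(2 * c / (u + v))\<^sup>2 \<le> c / u * (c / v)"
      by (simp add: power2_eq_square)
  qed
  moreover have "2 * real (Suc M) / real (M + 2) * real (M choose i) = 2 * c / (u + v)"
    unfolding uv(3) by (simp add: u_v_c_def(3))
  ultimately show ?thesis
    by (simp only:)
qed

text \<open>At interior lattice points the two laws have consecutive binomial weights of row
  \<open>K - 1\<close>. Summing \<open>choose_consecutive_ge\<close> over row
  \<open>M = K - 2\<close> gives exactly \<open>(K - 1) / K\<close>. The end points, each charged by
  only one law, are dropped. For \<open>K = 1\<close> the bound is 0.\<close>

lemma lattice_noise_affinity: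
  assumes "K > 0"
  shows "1 - 1 / real K \<le> (\<Sum>y\<in>label_lattice K.
    sqrt (pmf (lattice_noise K) (y - 1 / sqrt (real K)) * pmf (lattice_noise K) (y + 1 / sqrt (real K))))"
    (is "_ \<le> (\<Sum>y\<in>_. ?g y)")
proof (cases "K = 1")
  case True
  then show ?thesis by (auto intro!: sum_nonneg)
next
  case False
  then have "K = (K - 2) + 2"
    using assms by simp
  then obtain M where M: "K = M + 2"
    by blast
  let ?y = "\<lambda>j. (2 * real j - real K) / sqrt (real K)"
  have g: "?g (?y (Suc i)) = sqrt (real (Suc M choose i) * real (Suc M choose Suc i)) / 2 ^ Suc M" for i
  proof -
    have "?y (Suc i) - 1 / sqrt (real K) = (2 * real i - real (K - 1)) / sqrt (real K)"
      "?y (Suc i) + 1 / sqrt (real K) = (2 * real (Suc i) - real (K - 1)) / sqrt (real K)"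
      by (simp_all add: M add_divide_distrib[symmetric] diff_divide_distrib[symmetric])
    then show ?thesis
      using assms by (simp only: pmf_lattice_noise) (simp add: M real_sqrt_divide real_sqrt_mult)
  qed
  have "1 - 1 / real K = real (Suc M) / real (M + 2)"
    by (simp add: M field_simps)
  also have "\<dots> = (\<Sum>i\<le>M. 2 * real (Suc M) / real (M + 2) * real (M choose i) / 2 ^ Suc M)"
  proof -
    have "(\<Sum>i\<le>M. real (M choose i)) = 2 ^ M"
      using choose_row_sum[of M] by (metis of_nat_numeral of_nat_power of_nat_sum)
    then have "(\<Sum>i\<le>M. 2 * real (Suc M) / real (M + 2) * real (M choose i) / 2 ^ Suc M) =
        2 * real (Suc M) / real (M + 2) * 2 ^ M / 2 ^ Suc M"
      by (simp only: sum_distrib_left[symmetric] sum_divide_distrib[symmetric])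
    moreover have "2 * a / q * 2 ^ M / 2 ^ Suc M = a / q" for a q :: real
      by simp
    ultimately show ?thesis by (simp only:)
  qed
  also have "\<dots> \<le> (\<Sum>i\<le>M. ?g (?y (Suc i)))"
    unfolding g by (intro sum_mono divide_right_mono choose_consecutive_ge) auto
  also have "\<dots> = (\<Sum>y\<in>(\<lambda>i. ?y (Suc i)) ` {..M}. ?g y)"
  proof -
    have "inj_on (\<lambda>i. ?y (Suc i)) {..M}"
      using inj_lattice[OF assms, of "real K"] by (simp add: inj_def inj_on_def)
    then show ?thesis by (simp only: sum.reindex o_def)
  qed
  also have "\<dots> \<le> (\<Sum>y\<in>label_lattice K. ?g y)"
  proof (rule sum_mono2)
    show "(\<lambda>i. ?y (Suc i)) ` {..M} \<subseteq> label_lattice K"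
    proof
      fix y assume "y \<in> (\<lambda>i. ?y (Suc i)) ` {..M}"
      then obtain i where "i \<le> M" "y = ?y (Suc i)"
        by blast
      then show "y \<in> label_lattice K"
        unfolding label_lattice_def by (intro image_eqI[of _ _ "Suc i"]) (auto simp: M)
    qed
  qed (simp_all add: label_lattice_def)
  finally show ?thesis .
qed

section \<open>Mean, moment generating function and sub-Gaussianity of the lattice noise\<close>

lemma cosh_le_exp_square: "cosh (x::real) \<le> exp (x\<^sup>2 / 2)"
proof -
  have pos: "cosh x \<le> exp (x\<^sup>2 / 2)" if "x > 0" for x :: real
  proof -
    \<comment> \<open>Hoeffding's lemma for a fair coin and an interval of length
      \<open>2 * x\<close>: the left side is \<open>ln (cosh x)\<close> and the right side
      \<open>x^2 / 2\<close>.\<close>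
    have "- (2 * x) * (1/2) + ln (1 + (1/2) * (exp (2 * x) - 1)) \<le> (2 * x)\<^sup>2 / 8"
      by (rule Hoeffdings_lemma_aux) (use that in auto)
    then have "ln ((1 + exp (2 * x)) / 2) \<le> x + x\<^sup>2 / 2"
      by (simp add: field_simps power2_eq_square)
    then have "exp (ln ((1 + exp (2 * x)) / 2)) \<le> exp (x + x\<^sup>2 / 2)"
      by (subst exp_le_cancel_iff)
    also have "exp (ln ((1 + exp (2 * x)) / 2)) = (1 + exp (2 * x)) / 2"
      by (rule exp_ln) (simp add: add_pos_pos)
    finally have "(1 + exp x * exp x) / 2 \<le> exp (x\<^sup>2 / 2) * exp x"
      by (simp only: exp_double power2_eq_square[of "exp x"] exp_add mult.commute[of "exp x" "exp (x\<^sup>2 / 2)"])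
    moreover have "cosh x * exp x = (1 + exp x * exp x) / 2"
      by (simp add: cosh_field_def distrib_right mult_exp_exp)
    ultimately have "cosh x * exp x \<le> exp (x\<^sup>2 / 2) * exp x"
      by linarith
    then show ?thesis by simp
  qed
  show ?thesis using pos[of x] pos[of "- x"] by (cases "x = 0") (auto simp: neq_iff)
qed

text \<open>Each of the \<open>K - 1\<close> fair signs of size \<open>1 / sqrt K\<close>
  contributes one factor \<open>cosh\<close>; here the product comes from the binomial
  theorem.\<close>

lemma lattice_noise_mgf:
  "(\<integral>x. exp (l * x) \<partial>measure_pmf (lattice_noise K)) = cosh (l / sqrt (real K)) ^ (K - 1)"
proof -
  define M e where "M = K - 1" and "e = l / sqrt (real K)"
  have "(\<integral>x. exp (l * x) \<partial>measure_pmf (lattice_noise K)) =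
      (\<integral>k. exp (e * (2 * real k - real M)) \<partial>measure_pmf (binomial_pmf M (1/2)))"
    by (simp add: lattice_noise_def M_def e_def)
  also have "\<dots> = (\<Sum>k\<le>M. real (M choose k) * (1/2) ^ k * (1 - 1/2) ^ (M - k) * exp (e * (2 * real k - real M)))"
    by (subst expectation_binomial_pmf') auto
  also have "\<dots> = (\<Sum>k\<le>M. real (M choose k) * (exp e / 2) ^ k * (exp (- e) / 2) ^ (M - k))"
  proof (rule sum.cong[OF refl])
    fix k assume "k \<in> {..M}"
    then have "e * (2 * real k - real M) = real k * e + real (M - k) * (- e)"
      by (simp add: of_nat_diff algebra_simps)
    then have "exp (e * (2 * real k - real M)) = exp e ^ k * exp (- e) ^ (M - k)"
      by (simp only: exp_add exp_of_nat_mult)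
    then show "real (M choose k) * (1/2) ^ k * (1 - 1/2) ^ (M - k) * exp (e * (2 * real k - real M)) =
        real (M choose k) * (exp e / 2) ^ k * (exp (- e) / 2) ^ (M - k)"
      by (simp add: power_divide)
  qed
  also have "\<dots> = (exp e / 2 + exp (- e) / 2) ^ M"
    by (simp add: binomial_ring)
  finally show ?thesis
    by (simp add: M_def e_def cosh_def add_divide_distrib)
qed

lemma lattice_noise_mean: "(\<integral>x. x \<partial>measure_pmf (lattice_noise K)) = 0"
proof -
  define M where "M = K - 1"
  have e1: "(\<Sum>k\<le>M. real k * real (M choose k)) = real M * 2 ^ (M - 1)"
    using arg_cong[OF choose_linear_sum[of M], of real] by simp
  have e2: "(\<Sum>k\<le>M. real (M choose k)) = 2 ^ M"
    using arg_cong[OF choose_row_sum[of M], of real] by simp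
  have "(\<Sum>k\<le>M. real (M choose k) * (2 * real k - real M)) =
      2 * (\<Sum>k\<le>M. real k * real (M choose k)) - real M * (\<Sum>k\<le>M. real (M choose k))"
    by (simp add: sum_distrib_left sum_subtractf algebra_simps)
  also have "\<dots> = 0"
    \<comment> \<open>At \<open>M = 0\<close> the exponent \<open>M - 1\<close> is truncated, but
      the factor \<open>M\<close> vanishes.\<close>
    unfolding e1 e2 by (cases M) auto
  finally have z: "(\<Sum>k\<le>M. real (M choose k) * (2 * real k - real M)) = 0" .
  have "(\<integral>x. x \<partial>measure_pmf (lattice_noise K)) =
      (\<integral>k. (2 * real k - real M) / sqrt (real K) \<partial>measure_pmf (binomial_pmf M (1/2)))"
    by (simp add: lattice_noise_def M_def)
  also have "\<dots> = (\<Sum>k\<le>M. real (M choose k) * (1/2) ^ k * (1 - 1/2) ^ (M - k) *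
      ((2 * real k - real M) / sqrt (real K)))"
    by (subst expectation_binomial_pmf') auto
  also have "\<dots> = (\<Sum>k\<le>M. (1 / (2 ^ M * sqrt (real K))) * (real (M choose k) * (2 * real k - real M)))"
  proof (rule sum.cong[OF refl])
    fix k assume "k \<in> {..M}"
    then have "(1/2::real) ^ k * (1/2) ^ (M - k) = 1 / 2 ^ M"
      by (simp add: power_add[symmetric] power_one_over)
    then show "real (M choose k) * (1/2) ^ k * (1 - 1/2) ^ (M - k) * ((2 * real k - real M) / sqrt (real K))
        = (1 / (2 ^ M * sqrt (real K))) * (real (M choose k) * (2 * real k - real M))"
      by (simp add: mult.assoc)
  qed
  finally show ?thesis
    unfolding sum_distrib_left[symmetric] z by simp
qed

text \<open>The signs have total squared size \<open>(K - 1) / K\<close>, which is at most 1 and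
  hence at most \<open>\<eta>^2\<close>.\<close>

lemma subgaussian_lattice_noise:
  assumes "K > 0" "\<eta> \<ge> 1"
  shows "subgaussian (distr (measure_pmf (lattice_noise K)) borel (\<lambda>x. x)) \<eta>"
proof -
  let ?P = "measure_pmf (lattice_noise K)"
  let ?N = "distr ?P borel (\<lambda>x. x)"
  have "(\<integral>x. exp (l * x) \<partial>?N) \<le> exp (l\<^sup>2 * \<eta>\<^sup>2 / 2)" for l
  proof -
    have "(\<integral>x. exp (l * x) \<partial>?N) = cosh (l / sqrt (real K)) ^ (K - 1)"
      by (subst integral_distr) (auto simp: lattice_noise_mgf)
    also have "\<dots> \<le> exp ((l / sqrt (real K))\<^sup>2 / 2) ^ (K - 1)"
      by (intro power_mono cosh_le_exp_square) (simp add: cosh_real_nonneg)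
    also have "\<dots> = exp (real (K - 1) * ((l / sqrt (real K))\<^sup>2 / 2))"
      by (rule exp_of_nat_mult[symmetric])
    also have "\<dots> \<le> exp (l\<^sup>2 * \<eta>\<^sup>2 / 2)"
    proof -
      have "real (K - 1) / real K * (l\<^sup>2 / 2) \<le> 1 * (l\<^sup>2 / 2)"
        using assms by (intro mult_right_mono) auto
      then have "real (K - 1) * ((l / sqrt (real K))\<^sup>2 / 2) \<le> l\<^sup>2 / 2 * 1"
        by (simp add: power_divide)
      also have "\<dots> \<le> l\<^sup>2 / 2 * \<eta>\<^sup>2"
        using assms by (intro mult_left_mono) auto
      finally show ?thesis by simp
    qed
    finally show ?thesis .
  qed
  note mgf = this
  have int: "integrable ?N f" if "f \<in> borel_measurable borel" for f :: "real \<Rightarrow> real"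
    using that by (simp add: integrable_distr_eq integrable_measure_pmf_finite)
  have mean: "(\<integral>x. x \<partial>?N) = 0"
    by (subst integral_distr) (auto simp: lattice_noise_mean)
  have prob: "prob_space ?N"
    by (rule prob_space.prob_space_distr[OF prob_space_measure_pmf]) simp
  have "sets ?N = sets borel" "integrable ?N (\<lambda>x. x)" "integrable ?N (\<lambda>x. exp (l * x))" for l
    by (simp, (rule int, measurable)+)
  with mgf mean prob show ?thesis
    unfolding subgaussian_def by blast
qed

section \<open>Bayes regret for a fixed seed\<close>

definition basis_vec :: "nat \<Rightarrow> nat \<Rightarrow> real" where
  "basis_vec j = (\<lambda>i. if i = j then 1 else 0)"

text \<open>\<open>J\<close> is the set of positive coordinates, so that averaging over signs is a
  sum over \<open>Pow {..<D}\<close>. The amplitude is half a step of the lattice belonging to the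
  coordinate.\<close>

definition sign_vec :: "nat \<Rightarrow> (nat \<Rightarrow> nat) \<Rightarrow> nat set \<Rightarrow> nat \<Rightarrow> real" where
  "sign_vec D K J = (\<lambda>i. if i < D then (if i \<in> J then 1 else - 1) / sqrt (real (K i)) else 0)"

lemma inner_d_basis_vec: "j < d \<Longrightarrow> inner_d d v (basis_vec j) = v j"
  by (simp add: inner_d_def basis_vec_def if_distrib cong: if_cong)

text \<open>Pairs the sign patterns that differ exactly at \<open>i\<close>, which reduces the
  average to two-point problems.\<close>

lemma sum_Pow_remove:
  fixes f :: "'a set \<Rightarrow> real"
  assumes "finite S" "i \<in> S"
  shows "(\<Sum>J\<in>Pow S. f J) = (\<Sum>J\<in>Pow (S - {i}). f (insert i J) + f J)"
proof -
  have S: "S = insert i (S - {i})"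
    using assms by auto
  have "(\<Sum>J\<in>Pow S. f J) = (\<Sum>J\<in>Pow (S - {i}). f J) + (\<Sum>J\<in>insert i ` Pow (S - {i}). f J)"
    by (subst S, subst Pow_insert, rule sum.union_disjoint) (use assms in auto)
  also have "(\<Sum>J\<in>insert i ` Pow (S - {i}). f J) = (\<Sum>J\<in>Pow (S - {i}). f (insert i J))"
    by (subst sum.reindex) (auto simp: inj_on_def)
  finally show ?thesis by (simp add: sum.distrib)
qed

lemma sum_lattice_noise_shift:
  assumes "K > 0" "\<mu> = 1 / sqrt (real K) \<or> \<mu> = - (1 / sqrt (real K))"
  shows "(\<Sum>y\<in>label_lattice K. pmf (lattice_noise K) (y - \<mu>)) = 1"
proof -
  have "(\<Sum>y\<in>label_lattice K. pmf (lattice_noise K) (y - \<mu>)) =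
      (\<Sum>x\<in>(\<lambda>y. y - \<mu>) ` label_lattice K. pmf (lattice_noise K) x)"
    by (subst sum.reindex) (auto simp: inj_on_def)
  also have "\<dots> = 1"
  proof (rule sum_pmf_eq_1)
    show "set_pmf (lattice_noise K) \<subseteq> (\<lambda>y. y - \<mu>) ` label_lattice K"
    proof
      fix x assume "x \<in> set_pmf (lattice_noise K)"
      then have "\<mu> + x \<in> label_lattice K"
        using assms lattice_noise_shift_up lattice_noise_shift_down by blast
      then show "x \<in> (\<lambda>y. y - \<mu>) ` label_lattice K"
        by (intro image_eqI[of _ _ "\<mu> + x"]) auto
    qed
  qed (simp add: label_lattice_def)
  finally show ?thesis .
qed

text \<open>Round \<open>t\<close> shows the basis vector of coordinate \<open>c t\<close>. The
  resolution \<open>K i\<close> fixes both the amplitude of sign \<open>i\<close> and the noise on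
  its labels.\<close>

locale sign_design =
  fixes d D T :: nat and c :: "nat \<Rightarrow> nat" and K :: "nat \<Rightarrow> nat"
  assumes K_pos: "\<And>i. K i > 0" and c_less: "\<And>t. t < T \<Longrightarrow> c t < D" and D_le: "D \<le> d"
begin

abbreviation "hit i \<equiv> {t. t < T \<and> c t = i}"

definition inputs :: "nat \<Rightarrow> nat \<Rightarrow> real" where "inputs t = basis_vec (c t)"

lemma inner_inputs: "t < T \<Longrightarrow> inner_d d v (inputs t) = v (c t)"
  unfolding inputs_def using c_less D_le by (intro inner_d_basis_vec) force

abbreviation mean :: "nat set \<Rightarrow> nat \<Rightarrow> real" where
  "mean J t \<equiv> inner_d d (sign_vec D K J) (inputs t)"

abbreviation noise :: "nat \<Rightarrow> real pmf" where "noise t \<equiv> lattice_noise (K (c t))"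

lemma mean_cases:
  "t < T \<Longrightarrow> mean J t = (if c t \<in> J then 1 / sqrt (real (K (c t))) else - (1 / sqrt (real (K (c t)))))"
  using c_less by (simp add: inner_inputs sign_vec_def)

section \<open>Bayes regret against a fixed query rule, predictor and seed\<close>

context
  fixes qry :: "real \<Rightarrow> nat \<Rightarrow> history \<Rightarrow> (nat \<Rightarrow> real) \<Rightarrow> bool"
    and pred :: "real \<Rightarrow> nat \<Rightarrow> history \<Rightarrow> (nat \<Rightarrow> real) \<Rightarrow> real" and r :: real
begin

interpretation label_tree qry r inputs "\<lambda>t. label_lattice (K (c t))"
  by unfold_locales (simp add: label_lattice_def)

definition label_pmf :: "nat set \<Rightarrow> nat \<Rightarrow> real \<Rightarrow> real" where
  "label_pmf J t y = pmf (noise t) (y - mean J t)"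

text \<open>The expectation over the noise given the sign pattern \<open>J\<close>, as
  \<open>expect_eq_sum\<close> confirms. The tree is the same for every \<open>J\<close>; only the
  likelihood changes.\<close>

definition expect :: "nat set \<Rightarrow> (history \<Rightarrow> real) \<Rightarrow> real" where
  "expect J F = tree_sum T (\<lambda>h. lik (label_pmf J) h * F h)"

definition err :: "nat set \<Rightarrow> nat \<Rightarrow> history \<Rightarrow> real" where
  "err J t h = (pred r t (take t h) (inputs t) - mean J t)\<^sup>2"

lemma expect_eq_sum:
  "(\<Sum>\<xi>\<in>PiE {..<T} (\<lambda>t. set_pmf (noise t)). (\<Prod>t<T. pmf (noise t) (\<xi> t)) *
      F (hist_of qry r inputs (labels d (sign_vec D K J) inputs \<xi>) T)) = expect J F"
proof -
  have lab: "labels d (sign_vec D K J) inputs \<xi> = (\<lambda>t. mean J t + \<xi> t)" for \<xi>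
    by (simp add: fun_eq_iff labels_def)
  show ?thesis
    unfolding lab expect_def label_pmf_def
  proof (rule sum_noise_eq_tree_sum)
    fix t x assume "t < T" "x \<in> set_pmf (noise t)"
    then show "mean J t + x \<in> label_lattice (K (c t))"
      using lattice_noise_shift_up lattice_noise_shift_down K_pos by (simp add: mean_cases)
  next
    fix t assume "t < T"
    show "(\<Sum>x\<in>set_pmf (noise t). pmf (noise t) x) = 1"
      by (rule sum_pmf_eq_1) auto
  qed (auto simp: set_pmf_iff)
qed

lemma expect_mono: "(\<And>h. length h = T \<Longrightarrow> F h \<le> G h) \<Longrightarrow> expect J F \<le> expect J G"
  unfolding expect_def
  by (intro tree_sum_mono mult_left_mono lik_nonneg) (auto simp: label_pmf_def)

lemma expect_add: "expect J (\<lambda>h. F h + G h) = expect J F + expect J G"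
  by (simp add: expect_def distrib_left tree_sum_add)

lemma expect_cmult: "expect J (\<lambda>h. a * F h) = a * expect J F"
  using tree_sum_cmult[of T a "\<lambda>h. lik (label_pmf J) h * F h"] by (simp add: expect_def mult_ac)

lemma expect_sum: "expect J (\<lambda>h. \<Sum>i\<in>I. F i h) = (\<Sum>i\<in>I. expect J (F i))"
  by (simp add: expect_def sum_distrib_left tree_sum_sum)

lemma expect_nonneg: "(\<And>h. 0 \<le> F h) \<Longrightarrow> 0 \<le> expect J F"
  using expect_mono[of "\<lambda>_. 0" F J] expect_cmult[of J 0 "\<lambda>_. 0"] by simp

text \<open>Flipping sign \<open>i\<close> changes only the label laws of the rounds in
  \<open>hit i\<close>, where the affinity loss is at most \<open>1 / K i\<close>; in all other
  rounds the laws coincide and the affinity is 1. The loss in \<open>two_point_regret_ge\<close> is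
  then the expected number of queries of \<open>i\<close> over \<open>K i\<close>.\<close>

lemma coordinate_regret_pair:
  assumes "i < D" "i \<notin> J"
  shows "real (card (hit i)) / real (K i) *
      (2 - 2 / real (K i) * (expect (insert i J) (query_weight (\<lambda>s. if c s = i then 1 else 0)) +
         expect J (query_weight (\<lambda>s. if c s = i then 1 else 0))))
    \<le> expect (insert i J) (\<lambda>h. \<Sum>t\<in>hit i. err (insert i J) t h) + expect J (\<lambda>h. \<Sum>t\<in>hit i. err J t h)"
proof -
  define e where "e = 1 / sqrt (real (K i))"
  define \<delta> where "\<delta> s = (1 / real (K i)) * (if c s = i then 1 else 0)" for s
  have e2: "e\<^sup>2 = 1 / real (K i)"
    by (simp add: e_def power_divide)
  have qw: "expect J' (query_weight \<delta>) =
      1 / real (K i) * expect J' (query_weight (\<lambda>s. if c s = i then 1 else 0))" for J'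
    unfolding \<delta>_def[abs_def] query_weight_cmult expect_cmult ..
  have one: "(\<Sum>y\<in>label_lattice (K (c s)). label_pmf J' s y) = 1" if "s < T" for J' s
    unfolding label_pmf_def using that K_pos by (intro sum_lattice_noise_shift) (auto simp: mean_cases)
  have "real (card (hit i)) * e\<^sup>2 * (2 - 2 * (tree_sum T (\<lambda>h. lik (label_pmf (insert i J)) h * query_weight \<delta> h) +
              tree_sum T (\<lambda>h. lik (label_pmf J) h * query_weight \<delta> h)))
     \<le> tree_sum T (\<lambda>h. lik (label_pmf (insert i J)) h * (\<Sum>t\<in>hit i. (pred r t (take t h) (inputs t) - e)\<^sup>2)) +
       tree_sum T (\<lambda>h. lik (label_pmf J) h * (\<Sum>t\<in>hit i. (pred r t (take t h) (inputs t) + e)\<^sup>2))"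
  proof (rule two_point_regret_ge)
    fix s assume s: "s < T"
    show "1 - \<delta> s \<le> (\<Sum>y\<in>label_lattice (K (c s)). sqrt (label_pmf (insert i J) s y * label_pmf J s y))"
    proof (cases "c s = i")
      case True
      then show ?thesis
        using lattice_noise_affinity[OF K_pos, of i] assms s
        by (simp add: label_pmf_def mean_cases \<delta>_def)
    next
      case False
      then have "label_pmf (insert i J) s y = label_pmf J s y" for y
        using s by (simp add: label_pmf_def mean_cases)
      moreover have "0 \<le> label_pmf J s y" for y
        by (simp add: label_pmf_def)
      ultimately show ?thesis
        using one[OF s, of J] False by (simp add: \<delta>_def)
    qed
  qed (auto simp: one \<delta>_def, auto simp: label_pmf_def)
  also have "tree_sum T (\<lambda>h. lik (label_pmf (insert i J)) h * (\<Sum>t\<in>hit i. (pred r t (take t h) (inputs t) - e)\<^sup>2))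
      = expect (insert i J) (\<lambda>h. \<Sum>t\<in>hit i. err (insert i J) t h)"
    unfolding expect_def err_def by (intro tree_sum_cong) (auto simp: mean_cases e_def)
  also have "tree_sum T (\<lambda>h. lik (label_pmf J) h * (\<Sum>t\<in>hit i. (pred r t (take t h) (inputs t) + e)\<^sup>2))
      = expect J (\<lambda>h. \<Sum>t\<in>hit i. err J t h)"
    unfolding expect_def err_def using assms
    by (intro tree_sum_cong) (auto simp: mean_cases e_def intro!: sum.cong)
  finally show ?thesis
    unfolding expect_def[symmetric] qw e2 by (simp add: algebra_simps)
qed

text \<open>Sums the pair bound over the \<open>2 ^ (D - 1)\<close> choices of the other
  signs.\<close>

lemma coordinate_regret:
  assumes "i < D"
  shows "real (card (hit i)) / real (K i) *
      (2 ^ D - 2 / real (K i) * (\<Sum>J\<in>Pow {..<D}. expect J (query_weight (\<lambda>s. if c s = i then 1 else 0))))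
    \<le> (\<Sum>J\<in>Pow {..<D}. expect J (\<lambda>h. \<Sum>t\<in>hit i. err J t h))"
proof -
  let ?q = "query_weight (\<lambda>s. if c s = i then 1 else 0)"
  have card: "2 * real (card (Pow ({..<D} - {i}))) = 2 ^ D"
    using assms by (cases D) (simp_all add: card_Pow)
  have "real (card (hit i)) / real (K i) *
      (2 ^ D - 2 / real (K i) * (\<Sum>J\<in>Pow {..<D}. expect J ?q)) =
      (\<Sum>J\<in>Pow ({..<D} - {i}). real (card (hit i)) / real (K i) *
        (2 - 2 / real (K i) * (expect (insert i J) ?q + expect J ?q)))"
    using assms card
    by (subst sum_Pow_remove[of _ i])
      (simp_all only: sum_distrib_left[symmetric] sum_subtractf sum_constant finite_lessThan
        lessThan_iff mult.commute)
  also have "\<dots> \<le> (\<Sum>J\<in>Pow ({..<D} - {i}). expect (insert i J) (\<lambda>h. \<Sum>t\<in>hit i. err (insert i J) t h)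
      + expect J (\<lambda>h. \<Sum>t\<in>hit i. err J t h))"
    using assms by (intro sum_mono coordinate_regret_pair) auto
  also have "\<dots> = (\<Sum>J\<in>Pow {..<D}. expect J (\<lambda>h. \<Sum>t\<in>hit i. err J t h))"
    by (rule sum_Pow_remove[symmetric]) (use assms in auto)
  finally show ?thesis .
qed

text \<open>The price \<open>2 * lam\<close> per query acts as a Lagrange multiplier: it covers what
  a query of any coordinate can save, leaving a bound free of the query counts. Each round belongs
  to one coordinate, so errors and queries add up to the totals.\<close>

lemma total_regret:
  assumes lam: "\<And>i. i < D \<Longrightarrow> real (card (hit i)) \<le> lam * (real (K i))\<^sup>2"
  shows "2 ^ D * (\<Sum>i<D. real (card (hit i)) / real (K i)) \<le>
    (\<Sum>J\<in>Pow {..<D}. expect J (\<lambda>h. (\<Sum>t<T. err J t h) + 2 * lam * query_weight (\<lambda>_. 1) h))"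
proof -
  let ?q = "\<lambda>i. query_weight (\<lambda>s. if c s = i then 1 else 0)"
  have q0: "0 \<le> (\<Sum>J\<in>Pow {..<D}. expect J (?q i))" for i
    by (intro sum_nonneg expect_nonneg) (auto simp: query_weight_def intro!: sum_nonneg)
  have coord: "2 ^ D * (real (card (hit i)) / real (K i)) \<le>
      (\<Sum>J\<in>Pow {..<D}. expect J (\<lambda>h. (\<Sum>t\<in>hit i. err J t h) + 2 * lam * ?q i h))" if "i < D" for i
  proof -
    have "real (card (hit i)) / (real (K i))\<^sup>2 \<le> lam"
      using lam[OF that] K_pos[of i] by (simp add: field_simps)
    then have "2 * (real (card (hit i)) / (real (K i))\<^sup>2) * (\<Sum>J\<in>Pow {..<D}. expect J (?q i))
        \<le> 2 * lam * (\<Sum>J\<in>Pow {..<D}. expect J (?q i))"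
      using q0[of i] by (intro mult_right_mono) auto
    then show ?thesis
      using coordinate_regret[OF that]
      by (simp add: expect_add expect_cmult sum.distrib sum_distrib_left[symmetric]
          right_diff_distrib power2_eq_square mult.commute)
  qed
  have "2 ^ D * (\<Sum>i<D. real (card (hit i)) / real (K i)) =
      (\<Sum>i<D. 2 ^ D * (real (card (hit i)) / real (K i)))"
    by (rule sum_distrib_left)
  also have "\<dots> \<le> (\<Sum>i<D. \<Sum>J\<in>Pow {..<D}. expect J (\<lambda>h. (\<Sum>t\<in>hit i. err J t h) + 2 * lam * ?q i h))"
    by (intro sum_mono coord) auto
  also have "\<dots> = (\<Sum>J\<in>Pow {..<D}. expect J (\<lambda>h. \<Sum>i<D. (\<Sum>t\<in>hit i. err J t h) + 2 * lam * ?q i h))"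
    by (subst sum.swap) (simp only: expect_sum)
  also have "\<dots> \<le> (\<Sum>J\<in>Pow {..<D}. expect J (\<lambda>h. (\<Sum>t<T. err J t h) + 2 * lam * query_weight (\<lambda>_. 1) h))"
  proof (intro sum_mono expect_mono)
    fix J and h :: history assume h: "length h = T"
    have "(\<Sum>i<D. \<Sum>t\<in>hit i. err J t h) = (\<Sum>t<T. err J t h)"
      using sum.group[of "{..<T}" "{..<D}" c "\<lambda>t. err J t h"] c_less by (force simp: lessThan_def)
    moreover have "(\<Sum>i<D. ?q i h) = query_weight (\<lambda>_. 1) h"
      unfolding query_weight_sum[symmetric] using c_less h
      by (intro query_weight_cong) (auto simp: sum.delta)
    ultimately show "(\<Sum>i<D. (\<Sum>t\<in>hit i. err J t h) + 2 * lam * ?q i h) \<le>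
        (\<Sum>t<T. err J t h) + 2 * lam * query_weight (\<lambda>_. 1) h"
      by (simp add: sum.distrib sum_distrib_left[symmetric])
  qed
  finally show ?thesis .
qed

lemma total_regret_noise:
  assumes "\<And>i. i < D \<Longrightarrow> real (card (hit i)) \<le> lam * (real (K i))\<^sup>2"
  shows "2 ^ D * (\<Sum>i<D. real (card (hit i)) / real (K i)) \<le>
    (\<Sum>J\<in>Pow {..<D}. \<Sum>\<xi>\<in>PiE {..<T} (\<lambda>t. set_pmf (noise t)). (\<Prod>t<T. pmf (noise t) (\<xi> t)) *
      (regret d T pred qry r (sign_vec D K J) inputs (labels d (sign_vec D K J) inputs \<xi>) +
       2 * lam * real (nqueries T qry r inputs (labels d (sign_vec D K J) inputs \<xi>))))"
  using total_regret[OF assms]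
  unfolding expect_eq_sum[symmetric] regret_eq_hist nqueries_eq_query_weight err_def .

end
end

section \<open>Integration over the adversary, the noise and the seed\<close>

text \<open>Almost everywhere \<open>f\<close> agrees with a simple function carried by the points
  of \<open>S\<close>.\<close>

lemma nn_integral_finite_support:
  assumes "finite S" "\<And>s. s \<in> S \<Longrightarrow> {s} \<in> sets M" "AE x in M. x \<in> S"
  shows "(\<integral>\<^sup>+x. f x \<partial>M) = (\<Sum>s\<in>S. f s * emeasure M {s})"
proof -
  have "(\<integral>\<^sup>+x. f x \<partial>M) = (\<integral>\<^sup>+x. (\<Sum>s\<in>S. f s * indicator {s} x) \<partial>M)"
  proof (rule nn_integral_cong_AE, use assms(3) in eventually_elim)
    fix x assume "x \<in> S"
    then have "(\<Sum>s\<in>S. f s * indicator {s} x) = (\<Sum>s\<in>{x}. f s * indicator {s} x)"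
      using assms(1) by (intro sum.mono_neutral_right) (auto simp: indicator_def)
    then show "f x = (\<Sum>s\<in>S. f s * indicator {s} x)"
      by simp
  qed
  also have "\<dots> = (\<Sum>s\<in>S. f s * emeasure M {s})"
    using assms(2) by (subst nn_integral_sum) (auto intro!: sum.cong nn_integral_cmult_indicator)
  finally show ?thesis .
qed

text \<open>The box of supports has full measure and its singletons are boxes, so point masses are
  products.\<close>

lemma nn_integral_PiM_finite_pmf:
  fixes P :: "nat \<Rightarrow> real pmf"
  assumes fin: "\<And>t. finite (set_pmf (P t))"
  defines "N \<equiv> \<lambda>t. distr (measure_pmf (P t)) borel (\<lambda>x. x)"
  shows "(\<integral>\<^sup>+\<xi>. f \<xi> \<partial>PiM {..<T} N) =
    (\<Sum>\<xi>\<in>PiE {..<T} (\<lambda>t. set_pmf (P t)). f \<xi> * ennreal (\<Prod>t<T. pmf (P t) (\<xi> t)))"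
proof -
  have pN: "prob_space (N t)" for t
    unfolding N_def by (rule prob_space.prob_space_distr[OF prob_space_measure_pmf]) simp
  interpret product_prob_space N "{..<T}"
    using pN by (simp add: product_prob_space_def product_prob_space_axioms_def product_sigma_finite_def
        prob_space_imp_sigma_finite)
  let ?S = "PiE {..<T} (\<lambda>t. set_pmf (P t))"
  have sN: "sets (N t) = sets borel" for t
    by (simp add: N_def)
  have closed: "set_pmf (P t) \<in> sets borel" for t
    using fin by (intro borel_closed finite_imp_closed)
  have single: "{\<xi>} = PiE {..<T} (\<lambda>t. {\<xi> t})" if "\<xi> \<in> ?S" for \<xi>
    using that by (intro PiE_singleton[symmetric]) (auto simp: PiE_def)
  have "(\<integral>\<^sup>+\<xi>. f \<xi> \<partial>PiM {..<T} N) = (\<Sum>\<xi>\<in>?S. f \<xi> * emeasure (PiM {..<T} N) {\<xi>})"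
  proof (rule nn_integral_finite_support)
    show "finite ?S"
      using fin by (intro finite_PiE) auto
    show "{\<xi>} \<in> sets (PiM {..<T} N)" if "\<xi> \<in> ?S" for \<xi>
      unfolding single[OF that] by (intro sets_PiM_I_finite) (auto simp: sN)
    have S: "?S \<in> sets (PiM {..<T} N)"
      by (intro sets_PiM_I_finite) (auto simp: sN closed)
    have "emeasure (PiM {..<T} N) ?S = (\<Prod>t<T. emeasure (N t) (set_pmf (P t)))"
      by (intro emeasure_PiM) (auto simp: sN closed)
    also have "\<dots> = 1"
      by (intro prod.neutral) (auto simp: N_def emeasure_distr closed measure_pmf.emeasure_eq_1_AE AE_measure_pmf)
    finally have "emeasure (PiM {..<T} N) ?S = 1" .
    then show "AE \<xi> in PiM {..<T} N. \<xi> \<in> ?S"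
      using S by (simp add: P.AE_in_set_eq_1 P.emeasure_eq_measure)
  qed
  also have "\<dots> = (\<Sum>\<xi>\<in>?S. f \<xi> * ennreal (\<Prod>t<T. pmf (P t) (\<xi> t)))"
  proof (intro sum.cong refl arg_cong2[where f = "(*)"])
    fix \<xi> assume \<xi>: "\<xi> \<in> ?S"
    have "emeasure (PiM {..<T} N) {\<xi>} = (\<Prod>t<T. emeasure (N t) {\<xi> t})"
      unfolding single[OF \<xi>] by (intro emeasure_PiM) (auto simp: sN)
    also have "\<dots> = (\<Prod>t<T. ennreal (pmf (P t) (\<xi> t)))"
      by (intro prod.cong) (auto simp: N_def emeasure_distr emeasure_pmf_single)
    also have "\<dots> = ennreal (\<Prod>t<T. pmf (P t) (\<xi> t))"
      by (rule prod_ennreal) simp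
    finally show "emeasure (PiM {..<T} N) {\<xi>} = ennreal (\<Prod>t<T. pmf (P t) (\<xi> t))" .
  qed
  finally show ?thesis .
qed

section \<open>The randomised adversary and the passage to expected regret\<close>

context sign_design
begin

text \<open>Only the signs are random; the inputs are a fixed sequence.\<close>

definition adversary :: "((nat \<Rightarrow> real) \<times> (nat \<Rightarrow> nat \<Rightarrow> real)) measure" where
  "adversary = distr (measure_pmf (pmf_of_set (Pow {..<D}))) borel (\<lambda>J. (sign_vec D K J, inputs))"

definition noise_law :: "nat \<Rightarrow> real measure" where
  "noise_law t = distr (measure_pmf (noise t)) borel (\<lambda>x. x)"

lemma prob_space_adversary: "prob_space adversary"
  unfolding adversary_def by (rule prob_space.prob_space_distr[OF prob_space_measure_pmf]) simp

lemma sets_adversary: "sets adversary = sets borel"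
  by (simp add: adversary_def)

lemma AE_adversary:
  assumes "\<And>J. Q (sign_vec D K J) inputs"
  shows "AE (\<theta>, X) in adversary. Q \<theta> X"
proof -
  let ?F = "(\<lambda>J. (sign_vec D K J, inputs)) ` Pow {..<D}"
  have "closed ?F"
    by (intro finite_imp_closed) simp
  then have "?F \<in> sets borel"
    by (rule borel_closed)
  moreover have "set_pmf (pmf_of_set (Pow {..<D})) = Pow {..<D}"
    by (rule set_pmf_of_set) auto
  ultimately have "AE z in adversary. z \<in> ?F"
    unfolding adversary_def by (subst AE_distr_iff) (auto simp: AE_measure_pmf_iff)
  then show ?thesis
    by eventually_elim (use assms in auto)
qed

text \<open>Tonelli with the seed outermost: signs and noise become finite sums inside the seed
  integral, where a bound valid for every seed can be inserted.\<close>

lemma nn_integral_joint: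
  assumes R: "prob_space R"
    and f: "f \<in> borel_measurable (joint adversary T noise_law R)"
  shows "(\<integral>\<^sup>+z. f z \<partial>joint adversary T noise_law R) =
    (\<integral>\<^sup>+r. (\<Sum>J\<in>Pow {..<D}. \<Sum>\<xi>\<in>PiE {..<T} (\<lambda>t. set_pmf (noise t)).
       f ((sign_vec D K J, inputs), (\<xi>, r)) * ennreal (\<Prod>t<T. pmf (noise t) (\<xi> t))) \<partial>R) / 2 ^ D"
proof -
  let ?S = "PiE {..<T} (\<lambda>t. set_pmf (noise t))"
  let ?P = "PiM {..<T} noise_law"
  let ?a = "\<lambda>J. (sign_vec D K J, inputs)"
  let ?w = "\<lambda>\<xi>. ennreal (\<Prod>t<T. pmf (noise t) (\<xi> t))"
  have pN: "prob_space (noise_law t)" for t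
    unfolding noise_law_def by (rule prob_space.prob_space_distr[OF prob_space_measure_pmf]) simp
  interpret R: prob_space R by (rule R)
  interpret P: prob_space ?P by (rule prob_space_PiM) (rule pN)
  interpret PR: pair_prob_space ?P R ..
  have PR: "sigma_finite_measure (?P \<Otimes>\<^sub>M R)"
    by unfold_locales
  have fm: "f \<in> borel_measurable (adversary \<Otimes>\<^sub>M (?P \<Otimes>\<^sub>M R))"
    using f by (simp add: joint_def)
  have sp: "?a J \<in> space adversary" for J
    using sets_eq_imp_space_eq[OF sets_adversary] by simp
  have f1: "(\<lambda>z. f (?a J, z)) \<in> borel_measurable (?P \<Otimes>\<^sub>M R)" for J
    using measurable_Pair2[OF fm sp] .
  have spP: "\<xi> \<in> space ?P" if "\<xi> \<in> ?S" for \<xi>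
    using that by (auto simp: space_PiM noise_law_def)
  have f2: "(\<lambda>r. f (?a J, (\<xi>, r))) \<in> borel_measurable R" if "\<xi> \<in> ?S" for J \<xi>
    using measurable_Pair2[OF f1 spP[OF that]] .
  have inner: "(\<integral>\<^sup>+z. f (?a J, z) \<partial>(?P \<Otimes>\<^sub>M R)) = (\<integral>\<^sup>+r. (\<Sum>\<xi>\<in>?S. f (?a J, (\<xi>, r)) * ?w \<xi>) \<partial>R)" for J
  proof -
    have "(\<integral>\<^sup>+z. f (?a J, z) \<partial>(?P \<Otimes>\<^sub>M R)) = (\<integral>\<^sup>+\<xi>. \<integral>\<^sup>+r. f (?a J, (\<xi>, r)) \<partial>R \<partial>?P)"
      by (rule R.nn_integral_fst[OF f1, symmetric])
    also have "\<dots> = (\<Sum>\<xi>\<in>?S. (\<integral>\<^sup>+r. f (?a J, (\<xi>, r)) \<partial>R) * ?w \<xi>)"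
      unfolding noise_law_def[abs_def] by (rule nn_integral_PiM_finite_pmf) simp
    also have "\<dots> = (\<Sum>\<xi>\<in>?S. \<integral>\<^sup>+r. f (?a J, (\<xi>, r)) * ?w \<xi> \<partial>R)"
      by (intro sum.cong refl nn_integral_multc[symmetric] f2)
    also have "\<dots> = (\<integral>\<^sup>+r. (\<Sum>\<xi>\<in>?S. f (?a J, (\<xi>, r)) * ?w \<xi>) \<partial>R)"
      by (intro nn_integral_sum[symmetric] borel_measurable_times_ennreal f2) auto
    finally show ?thesis .
  qed
  have "(\<integral>\<^sup>+z. f z \<partial>joint adversary T noise_law R) = (\<integral>\<^sup>+a. \<integral>\<^sup>+z. f (a, z) \<partial>(?P \<Otimes>\<^sub>M R) \<partial>adversary)"
    unfolding joint_def by (rule sigma_finite_measure.nn_integral_fst[OF PR fm, symmetric])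
  also have "\<dots> = (\<integral>\<^sup>+J. \<integral>\<^sup>+z. f (?a J, z) \<partial>(?P \<Otimes>\<^sub>M R) \<partial>measure_pmf (pmf_of_set (Pow {..<D})))"
  proof -
    have "(\<lambda>a. \<integral>\<^sup>+z. f (a, z) \<partial>(?P \<Otimes>\<^sub>M R)) \<in> borel_measurable adversary"
      using sigma_finite_measure.borel_measurable_nn_integral_fst[OF PR fm] .
    then show ?thesis
      unfolding adversary_def by (subst nn_integral_distr) auto
  qed
  also have "\<dots> = (\<Sum>J\<in>Pow {..<D}. \<integral>\<^sup>+z. f (?a J, z) \<partial>(?P \<Otimes>\<^sub>M R)) / 2 ^ D"
    by (subst nn_integral_pmf_of_set) (auto simp: card_Pow)
  also have "(\<Sum>J\<in>Pow {..<D}. \<integral>\<^sup>+z. f (?a J, z) \<partial>(?P \<Otimes>\<^sub>M R)) =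
      (\<integral>\<^sup>+r. (\<Sum>J\<in>Pow {..<D}. \<Sum>\<xi>\<in>?S. f (?a J, (\<xi>, r)) * ?w \<xi>) \<partial>R)"
    unfolding inner
    by (intro nn_integral_sum[symmetric] borel_measurable_sum borel_measurable_times_ennreal f2) auto
  finally show ?thesis .
qed

text \<open>The left side of \<open>total_regret_noise\<close> does not depend on the seed, so it
  survives integration; the budget on expected queries then bounds the price paid.\<close>

lemma exp_regret_ge:
  assumes R: "prob_space R" and meas: "measurable_learner d T adversary noise_law R pred qry"
    and B: "exp_queries d T adversary noise_law R qry \<le> ennreal (real B)"
    and lam: "\<And>i. i < D \<Longrightarrow> real (card (hit i)) \<le> lam * (real (K i))\<^sup>2" and lam0: "0 \<le> lam"
  shows "ennreal ((\<Sum>i<D. real (card (hit i)) / real (K i)) - 2 * lam * real B)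
    \<le> exp_regret d T adversary noise_law R pred qry"
proof -
  interpret R: prob_space R by (rule R)
  let ?S = "PiE {..<T} (\<lambda>t. set_pmf (noise t))"
  let ?M = "joint adversary T noise_law R"
  let ?w = "\<lambda>\<xi>. \<Prod>t<T. pmf (noise t) (\<xi> t)"
  let ?a = "\<Sum>i<D. real (card (hit i)) / real (K i)"
  define reg where "reg = (\<lambda>z. case z of ((\<theta>, X), (\<xi>, r)) \<Rightarrow> regret d T pred qry r \<theta> X (labels d \<theta> X \<xi>))"
  define nq where "nq = (\<lambda>z. case z of ((\<theta>, X), (\<xi>, r)) \<Rightarrow> real (nqueries T qry r X (labels d \<theta> X \<xi>)))"
  have [measurable]: "reg \<in> borel_measurable ?M" "nq \<in> borel_measurable ?M"
    using meas by (simp_all add: measurable_learner_def reg_def nq_def)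
  have reg0: "0 \<le> reg z" and nq0: "0 \<le> nq z" for z
    by (auto simp: reg_def nq_def regret_def split: prod.splits intro: sum_nonneg)
  have "ennreal (2 ^ D * ?a) \<le> (\<Sum>J\<in>Pow {..<D}. \<Sum>\<xi>\<in>?S.
      ennreal (reg ((sign_vec D K J, inputs), (\<xi>, r)) + 2 * lam * nq ((sign_vec D K J, inputs), (\<xi>, r))) *
      ennreal (?w \<xi>))" for r
  proof -
    have "ennreal (2 ^ D * ?a) \<le> ennreal (\<Sum>J\<in>Pow {..<D}. \<Sum>\<xi>\<in>?S.
      ?w \<xi> * (reg ((sign_vec D K J, inputs), (\<xi>, r)) + 2 * lam * nq ((sign_vec D K J, inputs), (\<xi>, r))))"
      unfolding reg_def nq_def prod.case by (intro ennreal_leI total_regret_noise lam)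
    also have "\<dots> = (\<Sum>J\<in>Pow {..<D}. \<Sum>\<xi>\<in>?S.
      ennreal (reg ((sign_vec D K J, inputs), (\<xi>, r)) + 2 * lam * nq ((sign_vec D K J, inputs), (\<xi>, r))) *
      ennreal (?w \<xi>))"
      using reg0 nq0 lam0
      by (simp add: sum_ennreal[symmetric] sum_nonneg prod_nonneg ennreal_mult mult.commute
         del: sum_ennreal)
    finally show ?thesis .
  qed
  then have "(\<integral>\<^sup>+r. ennreal (2 ^ D * ?a) \<partial>R) / 2 ^ D \<le> (\<integral>\<^sup>+z. ennreal (reg z + 2 * lam * nq z) \<partial>?M)"
    by (subst nn_integral_joint[OF R]) (simp, intro divide_right_mono_ennreal nn_integral_mono)
  also have "\<dots> = (\<integral>\<^sup>+z. ennreal (reg z) \<partial>?M) + ennreal (2 * lam) * (\<integral>\<^sup>+z. ennreal (nq z) \<partial>?M)"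
    using reg0 nq0 lam0
    by (simp add: ennreal_plus ennreal_mult nn_integral_add nn_integral_cmult)
  also have "\<dots> \<le> (\<integral>\<^sup>+z. ennreal (reg z) \<partial>?M) + ennreal (2 * lam) * ennreal (real B)"
    using B by (intro add_left_mono mult_left_mono) (auto simp: exp_queries_def nq_def)
  also have "(\<integral>\<^sup>+r. ennreal (2 ^ D * ?a) \<partial>R) / 2 ^ D = ennreal ?a"
  proof -
    have "(\<integral>\<^sup>+r. ennreal (2 ^ D * ?a) \<partial>R) = ennreal (2 ^ D * ?a)"
      by (simp add: R.emeasure_space_1)
    moreover have "(2::ennreal) ^ D = ennreal (2 ^ D)"
      by (simp add: ennreal_power[symmetric])
    ultimately show ?thesis
      by (simp add: divide_ennreal sum_nonneg del: nn_integral_const)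
  qed
  \<comment> \<open>The query price may be moved to the left because it is finite; the regret
    integral may be infinite.\<close>
  finally have "ennreal ?a - ennreal (2 * lam * real B) \<le> (\<integral>\<^sup>+z. ennreal (reg z) \<partial>?M)"
    using lam0 by (simp add: ennreal_mult[symmetric] ennreal_minus_le_iff add.commute)
  then show ?thesis
    using lam0 by (simp add: ennreal_minus exp_regret_def reg_def)
qed

end

section \<open>The block design\<close>

text \<open>The class contains \<open>q * k + i\<close> for all \<open>q < n div k\<close>. As
  \<open>k \<le> n\<close>, the quotient is at least 1 and rounding down loses at most a factor
  2.\<close>

lemma card_residue_class_ge:
  fixes n k i :: nat
  assumes "i < k" "k \<le> n"
  shows "real n / (2 * real k) \<le> real (card {j. j < n \<and> j mod k = i})"
proof -
  have k: "k > 0" using assms by simp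
  have "(\<lambda>q. q * k + i) ` {..<n div k} \<subseteq> {j. j < n \<and> j mod k = i}"
  proof safe
    fix q assume "q < n div k"
    then have "Suc q * k \<le> n"
      using k by (metis Suc_leI div_times_less_eq_dividend le_trans mult_le_mono1)
    then show "q * k + i < n"
      using assms(1) by simp
  qed (use assms in simp)
  then have "card ((\<lambda>q. q * k + i) ` {..<n div k}) \<le> card {j. j < n \<and> j mod k = i}"
    by (rule card_mono[rotated]) simp
  moreover have "card ((\<lambda>q. q * k + i) ` {..<n div k}) = n div k"
    using k by (subst card_image) (auto simp: inj_on_def)
  moreover have "n \<le> 2 * k * (n div k)"
  proof -
    have "n = k * (n div k) + n mod k" "n mod k < k" "n div k \<ge> 1"
      using k assms by (auto simp: div_greater_zero_iff Suc_le_eq)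
    moreover have "k * 1 \<le> k * (n div k)"
      using \<open>n div k \<ge> 1\<close> by (intro mult_le_mono2)
    ultimately show ?thesis by linarith
  qed
  ultimately have "real n \<le> 2 * real k * real (card {j. j < n \<and> j mod k = i})"
    by (metis (no_types, lifting) mult_le_mono2 of_nat_le_iff of_nat_mult of_nat_numeral order.trans)
  then show ?thesis using k by (simp add: field_simps)
qed

lemma in_subspace_of_dim_basis:
  assumes inj: "inj_on e {..<k}" and e: "\<And>j. j < k \<Longrightarrow> e j < d"
    and S: "\<And>x. x \<in> S \<Longrightarrow> \<exists>j<k. x = basis_vec (e j)"
  shows "in_subspace_of_dim d k S"
proof -
  have sum: "(\<Sum>j<k. a j * basis_vec (e j) (e l)) = a l" if "l < k" for a l
  proof -
    have "(\<Sum>j<k. a j * basis_vec (e j) (e l)) = (\<Sum>j<k. if j = l then a l else 0)"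
      using that inj by (intro sum.cong) (auto simp: basis_vec_def inj_on_def)
    then show ?thesis using that by simp
  qed
  show ?thesis
    unfolding in_subspace_of_dim_def
  proof (intro exI[of _ "\<lambda>j. basis_vec (e j)"] conjI allI impI ballI)
    fix j assume "j < k"
    then show "in_Rd d (basis_vec (e j))"
      using e[of j] by (auto simp: in_Rd_def basis_vec_def)
  next
    fix a :: "nat \<Rightarrow> real" and j
    assume "\<forall>i. (\<Sum>j<k. a j * basis_vec (e j) i) = 0" "j < k"
    then show "a j = 0" using sum[of j a] by simp
  next
    fix x assume "x \<in> S"
    then obtain l where l: "l < k" "x = basis_vec (e l)"
      using S by blast
    have "x i = (\<Sum>j<k. (if j = l then 1 else 0) * basis_vec (e j) i)" for i
      using l by (simp add: if_distrib[of "\<lambda>z. z * _"] cong: if_cong)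
    then show "\<exists>a. \<forall>i. x i = (\<Sum>j<k. a j * basis_vec (e j) i)"
      by (intro exI[of _ "\<lambda>j. if j = l then 1 else 0"] allI)
  qed
qed

text \<open>Rounds enumerate pairs \<open>(u, j)\<close> through \<open>f\<close>, coordinates
  enumerate pairs \<open>(u, k)\<close> through \<open>e\<close>, and round \<open>(u, j)\<close>
  shows coordinate \<open>(u, j mod dU u)\<close>. Each coordinate of block \<open>u\<close> is
  shown at least \<open>TU u / (2 * dU u)\<close> times; the 2 in that count causes the factor
  \<open>sqrt 2\<close>.\<close>

lemma coordinate_map_exists:
  fixes dU TU :: "nat \<Rightarrow> nat" and m :: nat
  defines "D \<equiv> \<Sum>u<m. dU u" and "T \<equiv> \<Sum>u<m. TU u"
  assumes le: "\<And>u. u < m \<Longrightarrow> 0 < dU u \<and> dU u \<le> TU u" and "D \<le> d"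
  obtains c I where
    "\<And>t. t < T \<Longrightarrow> c t < D"
    "\<forall>u<m. I u \<subseteq> {..<T} \<and> I u \<noteq> {} \<and> card (I u) = TU u \<and>
       in_subspace_of_dim d (dU u) ((\<lambda>t. basis_vec (c t)) ` I u)"
    "\<forall>u<m. \<forall>v<m. u \<noteq> v \<longrightarrow> I u \<inter> I v = {}"
    "(\<Union>u<m. I u) = {..<T}"
    "(\<Sum>u<m. sqrt (real (dU u) * real (TU u))) \<le>
       sqrt 2 * (\<Sum>i<D. sqrt (real (card {t. t < T \<and> c t = i})))"
proof -
  let ?ST = "SIGMA u:{..<m}. {..<TU u}" and ?SD = "SIGMA u:{..<m}. {..<dU u}"
  have card: "card ?ST = T" "card ?SD = D"
    by (simp_all add: T_def D_def)
  obtain f where f: "bij_betw f ?ST {..<T}"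
    using ex_bij_betw_finite_nat[of ?ST] card by (auto simp: atLeast0LessThan)
  obtain e where e: "bij_betw e ?SD {..<D}"
    using ex_bij_betw_finite_nat[of ?SD] card by (auto simp: atLeast0LessThan)
  define g where "g = inv_into ?ST f"
  have gf: "g (f z) = z" if "z \<in> ?ST" for z
    unfolding g_def using f that by (meson bij_betw_inv_into_left)
  define c where "c t = (case g t of (u, j) \<Rightarrow> e (u, j mod dU u))" for t
  define I where "I u = f ` ({u} \<times> {..<TU u})" for u
  have injf: "inj_on f ?ST" and imf: "f ` ?ST = {..<T}"
    using f by (auto simp: bij_betw_def)
  have inje: "inj_on e ?SD" and ime: "e ` ?SD = {..<D}"
    using e by (auto simp: bij_betw_def)
  have cf: "c (f (u, j)) = e (u, j mod dU u)" if "u < m" "j < TU u" for u j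
    using gf[of "(u, j)"] that by (simp add: c_def)
  have eD: "e (u, k) < D" if "u < m" "k < dU u" for u k
    using ime that by blast
  have fT: "f (u, j) < T" if "u < m" "j < TU u" for u j
    using imf that by blast
  have ex: "\<exists>u j. u < m \<and> j < TU u \<and> t = f (u, j)" if "t < T" for t
  proof -
    have "t \<in> f ` ?ST" using imf that by simp
    then show ?thesis by auto
  qed
  show thesis
  proof (rule that[of c I])
    fix t assume "t < T"
    then obtain u j where "u < m" "j < TU u" "t = f (u, j)"
      using ex by blast
    then show "c t < D"
      using le[of u] by (simp add: cf eD)
  next
    show "\<forall>u<m. I u \<subseteq> {..<T} \<and> I u \<noteq> {} \<and> card (I u) = TU u \<and>
       in_subspace_of_dim d (dU u) ((\<lambda>t. basis_vec (c t)) ` I u)"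
    proof (intro allI impI conjI)
      fix u assume u: "u < m"
      show "I u \<subseteq> {..<T}" using u fT by (auto simp: I_def)
      have "0 < TU u" using le[OF u] by linarith
      then show "I u \<noteq> {}" by (auto simp: I_def)
      have "inj_on f ({u} \<times> {..<TU u})"
        by (rule inj_on_subset[OF injf]) (use u in auto)
      then show "card (I u) = TU u"
        by (simp add: I_def card_image)
      show "in_subspace_of_dim d (dU u) ((\<lambda>t. basis_vec (c t)) ` I u)"
      proof (rule in_subspace_of_dim_basis[where e = "\<lambda>k. e (u, k)"])
        show "inj_on (\<lambda>k. e (u, k)) {..<dU u}"
          using inje u by (auto simp: inj_on_def)
        show "e (u, k) < d" if "k < dU u" for k
          using eD[OF u that] \<open>D \<le> d\<close> by simp
        fix x assume "x \<in> (\<lambda>t. basis_vec (c t)) ` I u"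
        then obtain j where "j < TU u" "x = basis_vec (c (f (u, j)))"
          by (auto simp: I_def)
        then show "\<exists>k<dU u. x = basis_vec (e (u, k))"
          using u le[OF u] by (intro exI[of _ "j mod dU u"]) (simp add: cf)
      qed
    qed
    show "\<forall>u<m. \<forall>v<m. u \<noteq> v \<longrightarrow> I u \<inter> I v = {}"
    proof (intro allI impI)
      fix u v assume "u < m" "v < m" "u \<noteq> v"
      then show "I u \<inter> I v = {}"
        unfolding I_def by (subst inj_on_image_Int[OF injf, symmetric]) auto
    qed
    show "(\<Union>u<m. I u) = {..<T}"
      unfolding imf[symmetric] by (auto simp: I_def)
  next
    let ?hit = "\<lambda>i. {t. t < T \<and> c t = i}"
    have hit: "real (TU u) / (2 * real (dU u)) \<le> real (card (?hit (e (u, k))))"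
      if u: "u < m" and k: "k < dU u" for u k
    proof -
      have "f ` (Pair u ` {j. j < TU u \<and> j mod dU u = k}) \<subseteq> ?hit (e (u, k))"
        using u by (auto simp: fT cf)
      then have "card (f ` (Pair u ` {j. j < TU u \<and> j mod dU u = k})) \<le> card (?hit (e (u, k)))"
        by (rule card_mono[rotated]) simp
      moreover have "card (f ` (Pair u ` {j. j < TU u \<and> j mod dU u = k})) =
          card {j. j < TU u \<and> j mod dU u = k}"
        using u by (subst card_image[OF inj_on_subset[OF injf]]) (auto intro: card_image inj_onI)
      ultimately show ?thesis
        using card_residue_class_ge[OF k, of "TU u"] le[OF u] by linarith
    qed
    have "sqrt (real (dU u) * real (TU u)) \<le>
        sqrt 2 * (\<Sum>k<dU u. sqrt (real (card (?hit (e (u, k))))))" if u: "u < m" for u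
    proof -
      have pos: "0 < real (dU u)" using le[OF u] by simp
      have "sqrt (real (dU u) * real (TU u)) =
          sqrt 2 * (real (dU u) * sqrt (real (TU u) / (2 * real (dU u))))"
      proof -
        have "sqrt (real (dU u) * real (TU u)) =
            sqrt (2 * ((real (dU u))\<^sup>2 * (real (TU u) / (2 * real (dU u)))))"
          using pos by (simp add: power2_eq_square)
        also have "\<dots> = sqrt 2 * (real (dU u) * sqrt (real (TU u) / (2 * real (dU u))))"
          by (simp only: real_sqrt_mult real_sqrt_abs abs_of_nat)
        finally show ?thesis .
      qed
      also have "real (dU u) * sqrt (real (TU u) / (2 * real (dU u))) =
          (\<Sum>k<dU u. sqrt (real (TU u) / (2 * real (dU u))))"
        by simp
      also have "sqrt 2 * \<dots> \<le> sqrt 2 * (\<Sum>k<dU u. sqrt (real (card (?hit (e (u, k))))))"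
        using hit[OF u] by (intro mult_left_mono sum_mono real_sqrt_le_mono) auto
      finally show ?thesis .
    qed
    then have "(\<Sum>u<m. sqrt (real (dU u) * real (TU u))) \<le>
        (\<Sum>u<m. sqrt 2 * (\<Sum>k<dU u. sqrt (real (card (?hit (e (u, k)))))))"
      by (intro sum_mono) auto
    also have "\<dots> = sqrt 2 * (\<Sum>(u, k)\<in>?SD. sqrt (real (card (?hit (e (u, k))))))"
      by (subst sum.Sigma[symmetric]) (auto simp: sum_distrib_left)
    also have "(\<Sum>(u, k)\<in>?SD. sqrt (real (card (?hit (e (u, k)))))) = (\<Sum>i<D. sqrt (real (card (?hit i))))"
      unfolding ime[symmetric] by (subst sum.reindex[OF inje]) (simp add: case_prod_unfold)
    finally show "(\<Sum>u<m. sqrt (real (dU u) * real (TU u))) \<le>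
        sqrt 2 * (\<Sum>i<D. sqrt (real (card (?hit i))))" .
  qed
qed

text \<open>The resolutions have sum at most \<open>4 * B + D\<close>, hence at most
  \<open>5 * B\<close>, so Cauchy-Schwarz gives a gain of \<open>s^2 / (5 * B)\<close>. The query
  price is \<open>s^2 / (8 * B)\<close>, and \<open>1/5 - 1/8 = 3/40\<close>.\<close>

lemma resolution_exists:
  fixes n :: "nat \<Rightarrow> real" and D B :: nat
  defines "s \<equiv> \<Sum>i<D. sqrt (n i)"
  assumes n: "\<And>i. 0 \<le> n i" and s0: "0 < s" and B: "D \<le> B"
  obtains K lam where "\<And>i. 0 < K i" "\<And>i. n i \<le> lam * (real (K i))\<^sup>2" "0 \<le> lam"
    "3 / 40 * s\<^sup>2 / real B \<le> (\<Sum>i<D. n i / real (K i)) - 2 * lam * real B"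
proof -
  \<comment> \<open>Rounding up preserves the bound by \<open>lam\<close>; \<open>max 1\<close>
    keeps the resolution positive where \<open>n i = 0\<close>. The factor 4 makes the price smaller
    than the gain.\<close>
  define K where "K i = max 1 (nat \<lceil>4 * real B / s * sqrt (n i)\<rceil>)" for i
  define lam where "lam = s\<^sup>2 / (16 * (real B)\<^sup>2)"
  have "D \<noteq> 0" using s0 by (cases D) (auto simp: s_def)
  then have B0: "0 < real B" using B by simp
  have K1: "0 < K i" for i by (simp add: K_def)
  have Kge: "4 * real B / s * sqrt (n i) \<le> real (K i)" for i
    unfolding K_def by linarith
  have Kle: "real (K i) \<le> 4 * real B / s * sqrt (n i) + 1" for i
  proof -
    have "0 \<le> 4 * real B / s * sqrt (n i)" using s0 n by simp
    then show ?thesis unfolding K_def by linarith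
  qed
  have lamK: "n i \<le> lam * (real (K i))\<^sup>2" for i
  proof -
    have "n i = lam * (4 * real B / s * sqrt (n i))\<^sup>2"
      using s0 B0 n[of i] by (simp add: lam_def power_mult_distrib power_divide)
    also have "\<dots> \<le> lam * (real (K i))\<^sup>2"
      using s0 n[of i] by (intro mult_left_mono power_mono Kge) (auto simp: lam_def)
    finally show ?thesis .
  qed
  \<comment> \<open>Cauchy--Schwarz for \<open>\<Sum>i<D. n i / K i\<close> in tangent form; \<open>v\<close> is the optimal slope.\<close>
  define v where "v = s / (5 * real B)"
  have tangent: "2 * v * sqrt (n i) - v\<^sup>2 * (4 * real B / s * sqrt (n i) + 1) \<le> n i / real (K i)" for i
  proof -
    have "0 \<le> (sqrt (n i) - v * real (K i))\<^sup>2 / real (K i)"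
      by simp
    also have "\<dots> = n i / real (K i) - 2 * v * sqrt (n i) + v\<^sup>2 * real (K i)"
      using K1[of i] n[of i] by (simp add: power2_diff power_mult_distrib add_divide_distrib
         diff_divide_distrib power2_eq_square[of "real (K i)"])
    finally have "2 * v * sqrt (n i) - v\<^sup>2 * real (K i) \<le> n i / real (K i)"
      by simp
    moreover have "v\<^sup>2 * real (K i) \<le> v\<^sup>2 * (4 * real B / s * sqrt (n i) + 1)"
      by (intro mult_left_mono Kle) simp
    ultimately show ?thesis by linarith
  qed
  have "s\<^sup>2 / (5 * real B) = 2 * v * s - v\<^sup>2 * (5 * real B)"
    using B0 by (simp add: v_def power2_eq_square field_simps)
  \<comment> \<open>Rounding up costs at most one unit per coordinate, and \<open>D \<le> B\<close>
    absorbs it.\<close>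
  also have "\<dots> \<le> 2 * v * s - v\<^sup>2 * (4 * real B + real D)"
    using B by (intro diff_left_mono mult_left_mono) auto
  also have "\<dots> = 2 * v * s - v\<^sup>2 * (4 * real B / s * s + real D)"
    using s0 by simp
  also have "\<dots> = (\<Sum>i<D. 2 * v * sqrt (n i) - v\<^sup>2 * (4 * real B / s * sqrt (n i) + 1))"
    unfolding sum_subtractf sum_distrib_left[symmetric] sum.distrib s_def[symmetric] by simp
  also have "\<dots> \<le> (\<Sum>i<D. n i / real (K i))"
    by (intro sum_mono tangent)
  finally have "s\<^sup>2 / (5 * real B) \<le> (\<Sum>i<D. n i / real (K i))" .
  moreover have "2 * lam * real B = s\<^sup>2 / (8 * real B)"
    using B0 by (simp add: lam_def power2_eq_square)
  moreover have "3 / 40 * s\<^sup>2 / real B = s\<^sup>2 / (5 * real B) - s\<^sup>2 / (8 * real B)"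
    using B0 by (simp add: field_simps)
  ultimately have "3 / 40 * s\<^sup>2 / real B \<le> (\<Sum>i<D. n i / real (K i)) - 2 * lam * real B"
    by linarith
  then show thesis
    using that[of K lam] K1 lamK by (simp add: lam_def)
qed

section \<open>Norm bounds of the design and assembly of the lower bound\<close>

lemma (in sign_design) design_bounds:
  "in_Rd d (sign_vec D K J)" "norm_d d (sign_vec D K J) \<le> sqrt (real d)"
  "t < T \<Longrightarrow> in_Rd d (inputs t)" "t < T \<Longrightarrow> norm_d d (inputs t) \<le> 1"
  "t < T \<Longrightarrow> \<bar>inner_d d (sign_vec D K J) (inputs t)\<bar> \<le> 1"
proof -
  have abs: "\<bar>sign_vec D K J i\<bar> \<le> 1" for i
    using K_pos[of i] by (simp add: sign_vec_def)
  then have "(sign_vec D K J i)\<^sup>2 \<le> 1" for i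
    by (simp add: abs_square_le_1)
  then have "(\<Sum>i<d. (sign_vec D K J i)\<^sup>2) \<le> (\<Sum>i<d. 1)"
    by (intro sum_mono)
  then show "norm_d d (sign_vec D K J) \<le> sqrt (real d)"
    by (simp add: norm_d_def)
  show "in_Rd d (sign_vec D K J)"
    using D_le by (simp add: in_Rd_def sign_vec_def)
  assume t: "t < T"
  then show "in_Rd d (inputs t)"
    using c_less[OF t] D_le by (auto simp: in_Rd_def inputs_def basis_vec_def)
  have "(\<Sum>i<d. (inputs t i)\<^sup>2) = (\<Sum>i<d. if i = c t then 1 else 0)"
    by (intro sum.cong) (auto simp: inputs_def basis_vec_def)
  then show "norm_d d (inputs t) \<le> 1"
    by (simp add: norm_d_def)
  show "\<bar>inner_d d (sign_vec D K J) (inputs t)\<bar> \<le> 1"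
    using t abs by (simp add: inner_inputs)
qed

theorem theorem3:
  shows "\<exists>c::real. c > 0 \<and>
    (\<forall>(\<eta>::real) (d::nat) (m::nat) (dU::nat \<Rightarrow> nat) (TU::nat \<Rightarrow> nat) (B::nat).
      \<eta> \<ge> 1 \<and> d > 0 \<and> m > 0 \<and> (\<forall>u<m. dU u > 0 \<and> TU u > 0 \<and> dU u \<le> TU u) \<and>
      (\<Sum>u<m. dU u) \<le> d \<and> B \<ge> (\<Sum>u<m. dU u) \<longrightarrow>
      (let T = (\<Sum>u<m. TU u) in
       \<exists>(A :: ((nat \<Rightarrow> real) \<times> (nat \<Rightarrow> nat \<Rightarrow> real)) measure) (N :: nat \<Rightarrow> real measure).
         prob_space A \<and> sets A = sets borel \<and>
         (\<forall>t<T. subgaussian (N t) \<eta>) \<and>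
         (AE (\<theta>, X) in A.
            in_Rd d \<theta> \<and> norm_d d \<theta> \<le> sqrt (real d) \<and>
            (\<forall>t<T. in_Rd d (X t) \<and> norm_d d (X t) \<le> 1 \<and> \<bar>inner_d d \<theta> (X t)\<bar> \<le> 1) \<and>
            (\<exists>I :: nat \<Rightarrow> nat set.
               (\<forall>u<m. I u \<subseteq> {..<T} \<and> I u \<noteq> {} \<and> card (I u) = TU u \<and>
                      in_subspace_of_dim d (dU u) (X ` I u)) \<and>
               (\<forall>u<m. \<forall>v<m. u \<noteq> v \<longrightarrow> I u \<inter> I v = {}) \<and>
               (\<Union>u<m. I u) = {..<T})) \<and>
         (\<forall>(R :: real measure) pred qry.
            prob_space R \<and> sets R = sets borel \<and>
            measurable_learner d T A N R pred qry \<and>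
            exp_queries d T A N R qry \<le> ennreal (real B) \<longrightarrow>
            exp_regret d T A N R pred qry \<ge>
              ennreal (c * (\<Sum>u<m. sqrt (real (dU u) * real (TU u)))\<^sup>2 / real B))))"
proof (intro exI[of _ "3/80 :: real"] conjI allI impI)
  fix \<eta> :: real and d m :: nat and dU TU :: "nat \<Rightarrow> nat" and B :: nat
  assume asm: "\<eta> \<ge> 1 \<and> d > 0 \<and> m > 0 \<and> (\<forall>u<m. dU u > 0 \<and> TU u > 0 \<and> dU u \<le> TU u) \<and>
      (\<Sum>u<m. dU u) \<le> d \<and> B \<ge> (\<Sum>u<m. dU u)"
  define T where "T = (\<Sum>u<m. TU u)"
  define D where "D = (\<Sum>u<m. dU u)"
  define S where "S = (\<Sum>u<m. sqrt (real (dU u) * real (TU u)))"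
  obtain c I where c: "\<And>t. t < T \<Longrightarrow> c t < D"
    and I: "\<forall>u<m. I u \<subseteq> {..<T} \<and> I u \<noteq> {} \<and> card (I u) = TU u \<and>
       in_subspace_of_dim d (dU u) ((\<lambda>t. basis_vec (c t)) ` I u)"
      "\<forall>u<m. \<forall>v<m. u \<noteq> v \<longrightarrow> I u \<inter> I v = {}" "(\<Union>u<m. I u) = {..<T}"
    and S_le: "S \<le> sqrt 2 * (\<Sum>i<D. sqrt (real (card {t. t < T \<and> c t = i})))"
    unfolding T_def D_def S_def
    by (rule coordinate_map_exists[of m dU TU d]) (use asm in auto)
  define s where "s = (\<Sum>i<D. sqrt (real (card {t. t < T \<and> c t = i})))"
  have "0 < S"
    unfolding S_def using asm by (intro sum_pos) auto
  then have s: "0 < s"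
    using less_le_trans[OF \<open>0 < S\<close> S_le] by (simp add: s_def[symmetric] zero_less_mult_iff)
  obtain K lam where K: "\<And>i. 0 < K i" "0 \<le> lam"
    and lam: "\<And>i. real (card {t. t < T \<and> c t = i}) \<le> lam * (real (K i))\<^sup>2"
    and bound: "3 / 40 * s\<^sup>2 / real B \<le>
      (\<Sum>i<D. real (card {t. t < T \<and> c t = i}) / real (K i)) - 2 * lam * real B"
    unfolding s_def
    by (rule resolution_exists[of "\<lambda>i. real (card {t. t < T \<and> c t = i})" D B])
      (use s asm in \<open>auto simp: s_def D_def\<close>)
  interpret sign_design d D T c K
    by unfold_locales (use K c asm in \<open>auto simp: D_def\<close>)
  \<comment> \<open>Squaring the factor \<open>sqrt 2\<close> lost in the block design halves
    \<open>3/40\<close> to the constant \<open>3/80\<close>.\<close>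
  have "S\<^sup>2 \<le> (sqrt 2 * s)\<^sup>2"
    using S_le \<open>0 < S\<close> by (intro power_mono) (auto simp: s_def)
  then have "S\<^sup>2 \<le> 2 * s\<^sup>2"
    by (simp add: power_mult_distrib)
  then have "3/80 * S\<^sup>2 / real B \<le> 3/40 * s\<^sup>2 / real B"
    by (intro divide_right_mono) auto
  note final = order.trans[OF this bound]
  show "let T = (\<Sum>u<m. TU u) in
       \<exists>(A :: ((nat \<Rightarrow> real) \<times> (nat \<Rightarrow> nat \<Rightarrow> real)) measure) (N :: nat \<Rightarrow> real measure).
         prob_space A \<and> sets A = sets borel \<and>
         (\<forall>t<T. subgaussian (N t) \<eta>) \<and>
         (AE (\<theta>, X) in A.
            in_Rd d \<theta> \<and> norm_d d \<theta> \<le> sqrt (real d) \<and>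
            (\<forall>t<T. in_Rd d (X t) \<and> norm_d d (X t) \<le> 1 \<and> \<bar>inner_d d \<theta> (X t)\<bar> \<le> 1) \<and>
            (\<exists>I :: nat \<Rightarrow> nat set.
               (\<forall>u<m. I u \<subseteq> {..<T} \<and> I u \<noteq> {} \<and> card (I u) = TU u \<and>
                      in_subspace_of_dim d (dU u) (X ` I u)) \<and>
               (\<forall>u<m. \<forall>v<m. u \<noteq> v \<longrightarrow> I u \<inter> I v = {}) \<and>
               (\<Union>u<m. I u) = {..<T})) \<and>
         (\<forall>(R :: real measure) pred qry.
            prob_space R \<and> sets R = sets borel \<and>
            measurable_learner d T A N R pred qry \<and>
            exp_queries d T A N R qry \<le> ennreal (real B) \<longrightarrow>
            exp_regret d T A N R pred qry \<ge>
              ennreal (3/80 * (\<Sum>u<m. sqrt (real (dU u) * real (TU u)))\<^sup>2 / real B))"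
    unfolding Let_def T_def[symmetric] S_def[symmetric]
  proof (intro exI[of _ adversary] exI[of _ noise_law] conjI allI impI)
    show "prob_space adversary" "sets adversary = sets borel"
      by (rule prob_space_adversary, rule sets_adversary)
    show "subgaussian (noise_law t) \<eta>" for t
      unfolding noise_law_def using K_pos asm by (intro subgaussian_lattice_noise) auto
    show "AE (\<theta>, X) in adversary.
            in_Rd d \<theta> \<and> norm_d d \<theta> \<le> sqrt (real d) \<and>
            (\<forall>t<T. in_Rd d (X t) \<and> norm_d d (X t) \<le> 1 \<and> \<bar>inner_d d \<theta> (X t)\<bar> \<le> 1) \<and>
            (\<exists>I :: nat \<Rightarrow> nat set.
               (\<forall>u<m. I u \<subseteq> {..<T} \<and> I u \<noteq> {} \<and> card (I u) = TU u \<and>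
                      in_subspace_of_dim d (dU u) (X ` I u)) \<and>
               (\<forall>u<m. \<forall>v<m. u \<noteq> v \<longrightarrow> I u \<inter> I v = {}) \<and>
               (\<Union>u<m. I u) = {..<T})"
      by (rule AE_adversary, intro conjI exI[of _ I] allI impI design_bounds)
        (use I in \<open>auto simp: inputs_def[abs_def]\<close>)
    fix R :: "real measure" and pred qry
    assume "prob_space R \<and> sets R = sets borel \<and>
      measurable_learner d T adversary noise_law R pred qry \<and>
      exp_queries d T adversary noise_law R qry \<le> ennreal (real B)"
    then have "ennreal ((\<Sum>i<D. real (card (hit i)) / real (K i)) - 2 * lam * real B)
        \<le> exp_regret d T adversary noise_law R pred qry"
      using lam K by (intro exp_regret_ge) auto
    then show "ennreal (3/80 * S\<^sup>2 / real B) \<le> exp_regret d T adversary noise_law R pred qry"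
      using ennreal_leI[OF final] by (rule order.trans[rotated])
  qed
qed simp

end
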